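(* Let $R$ be an oriented ray. Then $R$ is ubiquitous if and only if either all but finitely many arcs of $R$ are in-oriented or all but finitely many arcs of $R$ are out-oriented.
   Context: An oriented ray is a digraph whose underlying undirected graph is a ray (a one-way infinite path). An arc of an oriented ray $R$ is in-oriented if it is directed towards the unique vertex of $R$ whose undirected degree is $1$ (the first vertex of $R$), and out-oriented otherwise. A digraph $H$ is ubiquitous if every digraph $D$ which, for every $k\in\mathbb N$, contains $k$ pairwise vertex-disjoint subdigraphs isomorphic to $H$ also contains infinitely many pairwise vertex-disjoint subdigraphs isomorphic to $H$. *)

theory Defs
  imports "Graph_Theory.Graph_Theory" "HOL-Library.Infinite_Typeclass"
begin

text \<open>
  Digraphs have neither loops nor parallel arcs, may be infinite, and may contain pairs of
  antiparallel arcs: these are the pair digraphs satisfying \<open>pair_loopfree_digraph\<close>.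
\<close>

definition underlying_edges :: "'a pair_pre_digraph \<Rightarrow> 'a set set" where
  "underlying_edges G = {{u, v} | u v. (u, v) \<in> parcs G}"

definition undirected_degree :: "'a pair_pre_digraph \<Rightarrow> 'a \<Rightarrow> nat" where
  "undirected_degree G v = card {e \<in> underlying_edges G. v \<in> e}"

text \<open>The vertices of a one-way infinite path, listed along the path.\<close>

definition ray_enum :: "'a set \<Rightarrow> 'a set set \<Rightarrow> (nat \<Rightarrow> 'a) \<Rightarrow> bool" where
  "ray_enum V E x \<longleftrightarrow> bij_betw x UNIV V \<and> E = range (\<lambda>n. {x n, x (Suc n)})"

definition is_ray :: "'a set \<Rightarrow> 'a set set \<Rightarrow> bool" where
  "is_ray V E \<longleftrightarrow> (\<exists>x. ray_enum V E x)"

text \<open>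
  As \<^const>\<open>underlying_edges\<close> is a set, it does not see antiparallel arcs;
  \<^const>\<open>asym\<close> ensures that every edge of the ray carries exactly one arc.
\<close>

definition oriented_ray :: "'a pair_pre_digraph \<Rightarrow> bool" where
  "oriented_ray R \<longleftrightarrow> pair_loopfree_digraph R \<and> asym (parcs R) \<and>
     is_ray (pverts R) (underlying_edges R)"

definition first_vertex :: "'a pair_pre_digraph \<Rightarrow> 'a" where
  "first_vertex R = (THE v. v \<in> pverts R \<and> undirected_degree R v = 1)"

definition in_oriented :: "'a pair_pre_digraph \<Rightarrow> 'a \<times> 'a \<Rightarrow> bool" where
  "in_oriented R a \<longleftrightarrow> a \<in> parcs R \<and>
     (\<exists>x n. ray_enum (pverts R) (underlying_edges R) x \<and> x 0 = first_vertex R \<and>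
            a = (x (Suc n), x n))"

definition out_oriented :: "'a pair_pre_digraph \<Rightarrow> 'a \<times> 'a \<Rightarrow> bool" where
  "out_oriented R a \<longleftrightarrow> a \<in> parcs R \<and> \<not> in_oriented R a"

definition disjoint_copies ::
    "'a pair_pre_digraph \<Rightarrow> 'v pair_pre_digraph \<Rightarrow> 'v pair_pre_digraph set \<Rightarrow> bool" where
  "disjoint_copies H D F \<longleftrightarrow>
     (\<forall>S\<in>F. subgraph (with_proj S) (with_proj D) \<and> digraph_iso (with_proj H) (with_proj S)) \<and>
     pairwise (\<lambda>S T. pverts S \<inter> pverts T = {}) F"

text \<open>
  HOL cannot quantify over types inside a formula, so the type of the vertices of the
  host digraphs is a parameter.
\<close>

definition ubiquitous :: "'v itself \<Rightarrow> 'a pair_pre_digraph \<Rightarrow> bool" where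
  "ubiquitous (_ :: 'v itself) H \<longleftrightarrow>
     (\<forall>D :: 'v pair_pre_digraph. pair_loopfree_digraph D \<longrightarrow>
        (\<forall>k :: nat. \<exists>F. disjoint_copies H D F \<and> finite F \<and> card F = k) \<longrightarrow>
        (\<exists>F. disjoint_copies H D F \<and> infinite F))"


lemma first_vertex_eq:
  assumes x: "ray_enum (pverts R) (underlying_edges R) x"
  shows "first_vertex R = x 0"
proof -
  have inj: "x i = x j \<longleftrightarrow> i = j" for i j
    using x unfolding ray_enum_def bij_betw_def inj_on_def by blast
  have E: "underlying_edges R = range (\<lambda>n. {x n, x (Suc n)})"
    and V: "pverts R = range x"
    using x unfolding ray_enum_def bij_betw_def by auto
  have "{e \<in> underlying_edges R. x 0 \<in> e} = {{x 0, x (Suc 0)}}"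
    unfolding E by (auto simp: inj)
  then have 0: "undirected_degree R (x 0) = 1"
    unfolding undirected_degree_def by simp
  have Suc: "undirected_degree R (x (Suc n)) = 2" for n
  proof -
    have "{e \<in> underlying_edges R. x (Suc n) \<in> e}
        = {{x n, x (Suc n)}, {x (Suc n), x (Suc (Suc n))}}"
      unfolding E by (auto simp: inj)
    moreover have "{x n, x (Suc n)} \<noteq> {x (Suc n), x (Suc (Suc n))}"
      by (auto simp: doubleton_eq_iff inj)
    ultimately show ?thesis
      unfolding undirected_degree_def by simp
  qed
  show ?thesis
    unfolding first_vertex_def
  proof (rule the_equality)
    show "x 0 \<in> pverts R \<and> undirected_degree R (x 0) = 1"
      using 0 V by simp
    fix v assume v: "v \<in> pverts R \<and> undirected_degree R v = 1"
    then obtain i where "v = x i" using V by auto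
    with v Suc show "v = x 0" by (cases i) auto
  qed
qed

lemma ray_enum_unique:
  assumes x: "ray_enum (pverts R) (underlying_edges R) x"
    and y: "ray_enum (pverts R) (underlying_edges R) y"
  shows "x = y"
proof
  fix n
  have injx: "x i = x j \<longleftrightarrow> i = j" for i j
    using x unfolding ray_enum_def bij_betw_def inj_on_def by blast
  have injy: "y i = y j \<longleftrightarrow> i = j" for i j
    using y unfolding ray_enum_def bij_betw_def inj_on_def by blast
  have E: "range (\<lambda>n. {y n, y (Suc n)}) = range (\<lambda>n. {x n, x (Suc n)})"
    using x y unfolding ray_enum_def by simp
  show "x n = y n"
  proof (induction n rule: less_induct)
    case (less n)
    show ?case
    proof (cases n)
      case 0
      then show ?thesis using first_vertex_eq[OF x] first_vertex_eq[OF y] by simp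
    next
      case (Suc m)
      have m: "x m = y m" using less Suc by simp
      have "{y m, y (Suc m)} \<in> range (\<lambda>n. {x n, x (Suc n)})"
        unfolding E[symmetric] by (rule rangeI)
      then obtain k where "{y m, y (Suc m)} = {x k, x (Suc k)}" by auto
      then consider "x m = x k" "y (Suc m) = x (Suc k)" | "x m = x (Suc k)" "y (Suc m) = x k"
        unfolding m doubleton_eq_iff by blast
      then show ?thesis
      proof cases
        case 1
        then have "m = k" by (simp add: injx)
        with 1 show ?thesis by (simp add: Suc)
      next
        case 2
        then have k: "m = Suc k" by (simp add: injx)
        then have "x k = y k" using less Suc by simp
        with 2 k show ?thesis by (simp add: injy)
      qed
    qed
  qed
qed

lemma in_oriented_iff:
  assumes "ray_enum (pverts R) (underlying_edges R) x"
  shows "in_oriented R a \<longleftrightarrow> a \<in> parcs R \<and> (\<exists>n. a = (x (Suc n), x n))"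
proof -
  have "ray_enum (pverts R) (underlying_edges R) y \<and> y 0 = first_vertex R \<longleftrightarrow> y = x" for y
    using assms first_vertex_eq[OF assms] ray_enum_unique[OF assms, of y] by auto
  then have "(\<exists>y n. ray_enum (pverts R) (underlying_edges R) y \<and> y 0 = first_vertex R \<and>
            a = (y (Suc n), y n)) \<longleftrightarrow> (\<exists>n. a = (x (Suc n), x n))"
    by (simp add: conj_assoc[symmetric])
  then show ?thesis
    unfolding in_oriented_def by (rule arg_cong)
qed

lemma out_oriented_iff:
  assumes x: "ray_enum (pverts R) (underlying_edges R) x"
  shows "out_oriented R a \<longleftrightarrow> a \<in> parcs R \<and> (\<exists>n. a = (x n, x (Suc n)))"
proof -
  have inj: "x i = x j \<longleftrightarrow> i = j" for i j
    using x unfolding ray_enum_def bij_betw_def inj_on_def by blast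
  have "\<exists>n. a = (x n, x (Suc n)) \<or> a = (x (Suc n), x n)" if "a \<in> parcs R"
  proof -
    have "{fst a, snd a} \<in> underlying_edges R"
      using that unfolding underlying_edges_def by force
    then have "{fst a, snd a} \<in> range (\<lambda>n. {x n, x (Suc n)})"
      using x unfolding ray_enum_def by simp
    then obtain n where "{fst a, snd a} = {x n, x (Suc n)}" by blast
    then show ?thesis
      unfolding doubleton_eq_iff prod_eq_iff by auto
  qed
  moreover have "(x n, x (Suc n)) \<noteq> (x (Suc m), x m)" for n m
    by (simp add: inj)
  ultimately show ?thesis
    unfolding out_oriented_def in_oriented_iff[OF x] by blast
qed

end

theory Submission
  imports Defs "HOL-Library.Ramsey"
begin

text \<open>
  Suppose that almost all arcs are out-oriented (otherwise reverse all arcs), so that a copy of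
  the ray is a finite oriented path followed by a directed ray. As in Halin's theorem, one builds
  infinitely many disjoint directed rays step by step, fixing longer and longer initial segments
  and rerouting the rest; the rerouting is a stable marriage in which a present ray prefers to
  leave early and a new ray prefers to be joined late, so each ray switches at most once. The
  rays obtained start in disjoint copies of the finite path, but may meet the copies belonging to
  other rays. As a copy meets boundedly many rays, Ramsey's theorem yields infinitely many rays
  with no such conflict.

  Conversely, if both orientations occur infinitely often, take \<open>k\<close> copies of the ray for every
  \<open>k\<close> and let any two copies from different batches cross infinitely often, identifying a local
  source of one with a local sink of the other. If the crossings are sparse enough, every copy of
  the ray in this digraph eventually runs along one of the given copies: on leaving a finite
  initial part it follows one of them for so long that its next arc at the next crossing must
  have the orientation of the next arc there, and neither arc of the crossing ray has it.
  Hence all members of a disjoint family come from the same batch.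
\<close>

section \<open>Oriented rays as patterns\<close>

text \<open>\<open>\<sigma> n\<close> says that the \<open>n\<close>-th arc points away from the first vertex.\<close>

definition pattern_copy :: "(nat \<Rightarrow> bool) \<Rightarrow> ('v \<times> 'v) set \<Rightarrow> (nat \<Rightarrow> 'v) \<Rightarrow> bool" where
  "pattern_copy \<sigma> E c \<longleftrightarrow>
     inj c \<and> (\<forall>n. if \<sigma> n then (c n, c (Suc n)) \<in> E else (c (Suc n), c n) \<in> E)"

text \<open>Only different indices are separated; injectivity of a single \<open>c i\<close> is part
  of \<open>pattern_copy\<close>. Indexed families are used because rerouting changes a ray but
  keeps its index.\<close>

definition disjoint_ranges :: "'i set \<Rightarrow> ('i \<Rightarrow> nat \<Rightarrow> 'v) \<Rightarrow> bool" where
  "disjoint_ranges I c \<longleftrightarrow> (\<forall>i\<in>I. \<forall>j\<in>I. \<forall>m n. c i m = c j n \<longrightarrow> i = j)"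

abbreviation directed_ray :: "('v \<times> 'v) set \<Rightarrow> (nat \<Rightarrow> 'v) \<Rightarrow> bool" where
  "directed_ray \<equiv> pattern_copy (\<lambda>_. True)"

lemma disjoint_rangesD:
  "disjoint_ranges I c \<Longrightarrow> i \<in> I \<Longrightarrow> j \<in> I \<Longrightarrow> c i m = c j n \<Longrightarrow> i = j"
  unfolding disjoint_ranges_def by blast

lemma disjoint_ranges_subset: "disjoint_ranges I c \<Longrightarrow> J \<subseteq> I \<Longrightarrow> disjoint_ranges J c"
  unfolding disjoint_ranges_def by blast

lemma pattern_copy_eq_iff: "pattern_copy \<sigma> E c \<Longrightarrow> c m = c n \<longleftrightarrow> m = n"
  unfolding pattern_copy_def inj_def by blast

section \<open>Directed rays: rerouting\<close>

text \<open>Deferred acceptance by extremality: among the states \<open>f\<close> satisfying the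
  invariant, one of maximal total advance is taken. There no ray can advance, so its current vertex
  lies on some \<open>q j\<close> and is not beaten by a later proposal to the same
  \<open>q j\<close>; this yields the matching \<open>g\<close>. An intersection passed earlier was
  superseded, hence lies before the point where its \<open>q j\<close> is joined.\<close>

lemma stable_switching:
  fixes r :: "'i \<Rightarrow> nat \<Rightarrow> 'v" and q :: "'j \<Rightarrow> nat \<Rightarrow> 'v"
  assumes finI: "finite I" and finJ: "finite J"
    and r: "disjoint_ranges I r" and q: "disjoint_ranges J q"
    and qinj: "\<And>j. j \<in> J \<Longrightarrow> inj (q j)"
    and many: "\<And>i. i \<in> I \<Longrightarrow> card I < card {j \<in> J. range (r i) \<inter> range (q j) \<noteq> {}}"
  obtains f g h where
    "\<And>i. i \<in> I \<Longrightarrow> g i \<in> J \<and> r i (f i) = q (g i) (h i)" "inj_on g I"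
    "\<And>i i' m k. \<lbrakk>i \<in> I; i' \<in> I; m < f i; h i' \<le> k\<rbrakk> \<Longrightarrow> r i m \<noteq> q (g i') k"
    "\<And>i j m k. \<lbrakk>i \<in> I; j \<in> J; j \<notin> g ` I; m \<le> f i\<rbrakk> \<Longrightarrow> r i m \<noteq> q j k"
proof -
  \<comment> \<open>\<open>f i\<close> is the position of the current proposal of ray \<open>i\<close>; \<open>Inv\<close> says that every
    earlier proposal to \<open>q j\<close> has been superseded by one further along \<open>q j\<close>.\<close>
  define Inv where "Inv f \<longleftrightarrow> (\<forall>i\<in>I. \<forall>m<f i. \<forall>j\<in>J. \<forall>k. r i m = q j k \<longrightarrow>
      (\<exists>i'\<in>I. \<exists>k'>k. r i' (f i') = q j k'))" for f
  \<comment> \<open>There are finitely many \<open>q j\<close>, so before some position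
    \<open>b i\<close> ray \<open>i\<close> has met every \<open>q j\<close> that it meets at
    all.\<close>
  have "\<exists>b. \<forall>j\<in>J. range (r i) \<inter> range (q j) \<noteq> {} \<longrightarrow> (\<exists>m<b. r i m \<in> range (q j))" for i
  proof -
    have "\<forall>j. \<exists>b. range (r i) \<inter> range (q j) \<noteq> {} \<longrightarrow> r i b \<in> range (q j)" by blast
    then obtain b where b: "\<And>j. range (r i) \<inter> range (q j) \<noteq> {} \<Longrightarrow> r i (b j) \<in> range (q j)"
      by metis
    have "b j < Suc (Max (b ` J))" if "j \<in> J" for j
      using that finJ by (simp add: le_imp_less_Suc)
    with b show ?thesis by blast
  qed
  then obtain b where b: "\<And>i j. \<lbrakk>j \<in> J; range (r i) \<inter> range (q j) \<noteq> {}\<rbrakk> \<Longrightarrow> \<exists>m<b i. r i m \<in> range (q j)"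
    by metis
  \<comment> \<open>Beyond \<open>b i\<close>, ray \<open>i\<close> has been superseded on every
    \<open>q j\<close> that it meets. A vertex lies on at most one \<open>q j\<close>, so the
    superseding rays are distinct, and by \<open>many\<close> there would be more than
    \<open>card I\<close> of them.\<close>
  have bound: "f i \<le> b i" if f: "Inv f" and i: "i \<in> I" for f i
  proof (rule ccontr)
    assume "\<not> f i \<le> b i"
    then have lt: "b i < f i" by simp
    let ?J = "{j \<in> J. range (r i) \<inter> range (q j) \<noteq> {}}"
    have "\<forall>j\<in>?J. \<exists>i'. i' \<in> I \<and> r i' (f i') \<in> range (q j)"
    proof
      fix j assume j: "j \<in> ?J"
      then obtain m k where "m < b i" "r i m = q j k" using b[of j i] by auto
      then show "\<exists>i'. i' \<in> I \<and> r i' (f i') \<in> range (q j)"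
        using f[unfolded Inv_def, rule_format, OF i, of m j k] j lt by auto
    qed
    from bchoice[OF this] obtain w
      where w: "\<And>j. j \<in> ?J \<Longrightarrow> w j \<in> I \<and> r (w j) (f (w j)) \<in> range (q j)" by blast
    have "inj_on w ?J"
    proof (rule inj_onI)
      fix j j' assume jj: "j \<in> ?J" "j' \<in> ?J" "w j = w j'"
      obtain k where "r (w j) (f (w j)) = q j k" using w[OF jj(1)] by blast
      moreover obtain k' where "r (w j') (f (w j')) = q j' k'" using w[OF jj(2)] by blast
      ultimately have "q j k = q j' k'" using jj(3) by simp
      then show "j = j'" using disjoint_rangesD[OF q] jj by blast
    qed
    then have "card ?J \<le> card I"
      using w by (intro card_inj_on_le[OF _ _ finI]) auto
    with many[OF i] show False by simp
  qed
  have "\<exists>f. Inv f \<and> (\<forall>f'. Inv f' \<longrightarrow> sum f' I \<le> sum f I)"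
  proof (rule ex_has_greatest_nat)
    show "Inv (\<lambda>_. 0)" by (simp add: Inv_def)
    show "\<forall>f. Inv f \<longrightarrow> sum f I < Suc (sum b I)"
      using bound by (auto intro!: sum_mono simp: less_Suc_eq_le)
  qed
  then obtain f where f: "Inv f" and fmax: "\<And>f'. Inv f' \<Longrightarrow> sum f' I \<le> sum f I" by blast
  have no_advance: "\<not> Inv (f(i := Suc (f i)))" if "i \<in> I" for i
  proof
    assume "Inv (f(i := Suc (f i)))"
    from fmax[OF this] have "sum (f(i := Suc (f i))) I \<le> sum f I" .
    moreover have "sum (f(i := Suc (f i))) I = Suc (sum f I)"
      using finI that by (simp add: sum.remove[of I i])
    ultimately show False by simp
  qed
  \<comment> \<open>If the current vertex lies on no \<open>q j\<close>, ray \<open>i\<close>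
    supersedes nobody, so advancing it keeps the invariant.\<close>
  have "\<exists>j\<in>J. r i (f i) \<in> range (q j)" if i: "i \<in> I" for i
  proof (rule ccontr)
    assume no: "\<not> (\<exists>j\<in>J. r i (f i) \<in> range (q j))"
    have "Inv (f(i := Suc (f i)))"
      unfolding Inv_def
    proof (intro ballI allI impI)
      fix a m j k
      assume a: "a \<in> I" "m < (f(i := Suc (f i))) a" "j \<in> J" "r a m = q j k"
      with no have "m < f a" by (auto simp: less_Suc_eq split: if_splits)
      with a f obtain i' k' where "i' \<in> I" "k' > k" "r i' (f i') = q j k'"
        unfolding Inv_def by blast
      moreover from this a no have "i' \<noteq> i" by auto
      ultimately show "\<exists>i'\<in>I. \<exists>k'>k. r i' ((f(i := Suc (f i))) i') = q j k'" by auto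
    qed
    with no_advance i show False by blast
  qed
  then have "\<forall>i. \<exists>j k. i \<in> I \<longrightarrow> j \<in> J \<and> r i (f i) = q j k" by blast
  then obtain g h where gh: "\<And>i. i \<in> I \<Longrightarrow> g i \<in> J \<and> r i (f i) = q (g i) (h i)" by metis
  \<comment> \<open>Of two rays proposing to the same \<open>q j\<close>, the one joining it earlier
    could advance: the other supersedes it and everything that it superseded.\<close>
  have no_conflict: False
    if i: "i \<in> I" and i2: "i2 \<in> I" and g: "g i = g i2" and h: "h i < h i2" for i i2
  proof -
    have ne: "i \<noteq> i2" using h by auto
    have "Inv (f(i := Suc (f i)))"
      unfolding Inv_def
    proof (intro ballI allI impI)
      fix a m j k
      assume a: "a \<in> I" "m < (f(i := Suc (f i))) a" "j \<in> J" "r a m = q j k"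
      have "\<exists>i'\<in>I. \<exists>k'>k. i' \<noteq> i \<and> r i' (f i') = q j k'"
      proof (cases "a = i \<and> m = f i")
        case True
        then have e: "q j k = q (g i) (h i)" using a gh i by simp
        then have "j = g i" using disjoint_rangesD[OF q _ _ e] a gh i by blast
        then have "k = h i" using e qinj[of j] a by (simp add: inj_eq)
        with \<open>j = g i\<close> g h gh i2 ne show ?thesis by metis
      next
        case False
        with a have "m < f a" by (auto split: if_splits)
        with a f obtain i' k' where i': "i' \<in> I" "k' > k" "r i' (f i') = q j k'"
          unfolding Inv_def by blast
        show ?thesis
        proof (cases "i' = i")
          case True
          then have e: "q j k' = q (g i) (h i)" using i' gh i by simp
          then have "j = g i" using disjoint_rangesD[OF q _ _ e] a gh i by blast
          then have "k' = h i" using e qinj[of j] a by (simp add: inj_eq)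
          then have "k < h i2" using i' h by simp
          with \<open>j = g i\<close> g gh i2 ne show ?thesis by metis
        qed (use i' in blast)
      qed
      then show "\<exists>i'\<in>I. \<exists>k'>k. r i' ((f(i := Suc (f i))) i') = q j k'" by auto
    qed
    with no_advance i show False by blast
  qed
  have ginj: "inj_on g I"
  proof (rule inj_onI)
    fix i i2 assume ii: "i \<in> I" "i2 \<in> I" "g i = g i2"
    then have "h i = h i2" using no_conflict[of i i2] no_conflict[of i2 i] by force
    then have "r i (f i) = r i2 (f i2)" using ii gh by metis
    then show "i = i2" using r ii disjoint_rangesD by metis
  qed
  have hit: "\<exists>i'\<in>I. g i' = j \<and> k < h i'"
    if hh: "i \<in> I" "m < f i" "j \<in> J" "r i m = q j k" for i m j k
  proof -
    obtain i' k' where i': "i' \<in> I" "k' > k" "r i' (f i') = q j k'"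
      using f hh unfolding Inv_def by blast
    then have e: "q (g i') (h i') = q j k'" using gh by metis
    then have "g i' = j" using disjoint_rangesD[OF q _ _ e] hh gh i' by blast
    moreover from this have "h i' = k'" using e qinj[of j] hh by (simp add: inj_eq)
    ultimately show ?thesis using i' by blast
  qed
  show ?thesis
  proof (rule that[OF gh ginj])
    fix i i' m k assume a: "i \<in> I" "i' \<in> I" "m < f i" "h i' \<le> k"
    show "r i m \<noteq> q (g i') k"
    proof
      assume "r i m = q (g i') k"
      from hit[OF a(1,3) _ this] gh a obtain i'' where "i'' \<in> I" "g i'' = g i'" "k < h i''" by blast
      then have "i'' = i'" using inj_onD[OF ginj] a by blast
      with \<open>k < h i''\<close> a show False by simp
    qed
  next
    fix i j m k assume a: "i \<in> I" "j \<in> J" "j \<notin> g ` I" "m \<le> f i"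
    show "r i m \<noteq> q j k"
    proof
      assume e: "r i m = q j k"
      show False
      proof (cases "m = f i")
        case True
        then have e': "q j k = q (g i) (h i)" using e a gh by simp
        then have "j = g i" using disjoint_rangesD[OF q _ _ e'] a gh by blast
        with a show False by blast
      next
        case False
        with hit[OF a(1) _ a(2) e] a show False by auto
      qed
    qed
  qed
qed

lemma directed_ray_switch:
  assumes r: "directed_ray E r" and q: "directed_ray E q" and meet: "r a = q b"
    and avoid: "\<And>m k. m < a \<Longrightarrow> b \<le> k \<Longrightarrow> r m \<noteq> q k"
  shows "directed_ray E (\<lambda>m. if m \<le> a then r m else q (b + (m - a)))" (is "directed_ray E ?s")
  unfolding pattern_copy_def
proof (intro conjI allI)
  have s: "?s m = (if m < a then r m else q (b + (m - a)))" for m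
    using meet by auto
  show "inj ?s"
  proof (rule injI)
    fix m n assume "?s m = ?s n"
    then show "m = n" unfolding s
      using avoid[of m "b + (n - a)"] avoid[of n "b + (m - a)"]
      by (auto simp: pattern_copy_eq_iff[OF r] pattern_copy_eq_iff[OF q] split: if_splits)
  qed
  fix n
  have "(r n, r (Suc n)) \<in> E" "(q (b + (n - a)), q (Suc (b + (n - a)))) \<in> E"
    using r q unfolding pattern_copy_def by auto
  then show "if True then (?s n, ?s (Suc n)) \<in> E else (?s (Suc n), ?s n) \<in> E"
    using meet by (auto simp: Suc_diff_le not_le less_Suc_eq_le dest: le_antisym)
qed

text \<open>Rays meeting few of the \<open>q j\<close> are left alone and the \<open>q j\<close> met
  by them are discarded. Each other ray then meets more of the remaining \<open>q j\<close> than
  there are such rays, so \<open>stable_switching\<close> applies. The quadratic bound on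
  \<open>card J\<close> leaves a \<open>q j0\<close> that is neither discarded nor joined.\<close>

lemma directed_rays_extend_by_one:
  fixes r :: "'i \<Rightarrow> nat \<Rightarrow> 'v" and q :: "'j \<Rightarrow> nat \<Rightarrow> 'v"
  assumes finI: "finite I" and finJ: "finite J" and big: "card I * card I < card J"
    and r: "\<And>i. i \<in> I \<Longrightarrow> directed_ray E (r i)" and rdisj: "disjoint_ranges I r"
    and q: "\<And>j. j \<in> J \<Longrightarrow> directed_ray E (q j)" and qdisj: "disjoint_ranges J q"
  obtains r' j0 where "j0 \<in> J" "\<And>i. i \<in> I \<Longrightarrow> directed_ray E (r' i)"
    "\<And>i. i \<in> I \<Longrightarrow> r' i 0 = r i 0" "disjoint_ranges I r'"
    "\<And>i m k. i \<in> I \<Longrightarrow> r' i m \<noteq> q j0 k"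
    "\<And>i. i \<in> I \<Longrightarrow> range (r' i) \<subseteq> (\<Union>i\<in>I. range (r i)) \<union> (\<Union>j\<in>J. range (q j))"
proof -
  define hit where "hit C = {j \<in> J. \<exists>i\<in>C. range (r i) \<inter> range (q j) \<noteq> {}}" for C
  have fin_hit: "finite (hit C)" for C using finJ by (simp add: hit_def)
  \<comment> \<open>The rays in \<open>C\<close> meet so few of the \<open>q j\<close> that they can be kept unchanged.\<close>
  define P where "P C \<longleftrightarrow> C \<subseteq> I \<and> card (hit C) \<le> card I * card C" for C
  have "\<exists>C. P C \<and> (\<forall>C'. P C' \<longrightarrow> card C' \<le> card C)"
  proof (rule ex_has_greatest_nat)
    show "P {}" by (simp add: P_def hit_def)
    show "\<forall>C. P C \<longrightarrow> card C < Suc (card I)"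
      using finI by (auto simp: P_def less_Suc_eq_le intro: card_mono)
  qed
  then obtain C where C: "P C" and Cmax: "\<And>C'. P C' \<Longrightarrow> card C' \<le> card C" by blast
  have CI: "C \<subseteq> I" and finC: "finite C" using C finI finite_subset by (auto simp: P_def)
  define I' where "I' = I - C"
  define J' where "J' = J - hit C"
  have fin: "finite I'" "finite J'" and sub: "I' \<subseteq> I" "J' \<subseteq> J"
    using finI finJ by (auto simp: I'_def J'_def)
  have cI': "card I' = card I - card C" using CI finC by (simp add: I'_def card_Diff_subset)
  have cle: "card C \<le> card I" using CI finI by (simp add: card_mono)
  have many: "card I' < card {j \<in> J'. range (r i) \<inter> range (q j) \<noteq> {}}" if i: "i \<in> I'" for i
  proof (rule ccontr)
    assume "\<not> ?thesis"
    then have "card {j \<in> J'. range (r i) \<inter> range (q j) \<noteq> {}} \<le> card I"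
      using cI' by simp
    moreover have "hit (insert i C) \<subseteq> hit C \<union> {j \<in> J'. range (r i) \<inter> range (q j) \<noteq> {}}"
      by (auto simp: hit_def J'_def)
    then have "card (hit (insert i C)) \<le> card (hit C) + card {j \<in> J'. range (r i) \<inter> range (q j) \<noteq> {}}"
      using fin_hit fin by (intro order_trans[OF card_mono card_Un_le]) auto
    ultimately have "card (hit (insert i C)) \<le> card I * card C + card I"
      using C by (simp add: P_def)
    then have "P (insert i C)"
      using i CI finC by (simp add: P_def I'_def)
    from Cmax[OF this] show False using i finC by (simp add: I'_def)
  qed
  have qinj: "inj (q j)" if "j \<in> J'" for j
    using q[of j] that sub by (auto simp: pattern_copy_def)
  obtain f g h where
    gh: "\<And>i. i \<in> I' \<Longrightarrow> g i \<in> J' \<and> r i (f i) = q (g i) (h i)" and ginj: "inj_on g I'" and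
    avoid: "\<And>i i' m k. \<lbrakk>i \<in> I'; i' \<in> I'; m < f i; h i' \<le> k\<rbrakk> \<Longrightarrow> r i m \<noteq> q (g i') k" and
    free: "\<And>i j m k. \<lbrakk>i \<in> I'; j \<in> J'; j \<notin> g ` I'; m \<le> f i\<rbrakk> \<Longrightarrow> r i m \<noteq> q j k"
    by (rule stable_switching[OF fin disjoint_ranges_subset[OF rdisj sub(1)]
          disjoint_ranges_subset[OF qdisj sub(2)] qinj many]) blast+
  \<comment> \<open>The rays in \<open>C\<close> cost at most \<open>card I * card C\<close> of the
    \<open>q j\<close>, so more than \<open>card I * card I'\<close> of them remain.\<close>
  have "card I' < card J'"
  proof -
    have "card J - card (hit C) = card J'"
      unfolding J'_def by (rule card_Diff_subset[symmetric]) (use fin_hit in blast, auto simp: hit_def)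
    moreover have "card (hit C) \<le> card I * card C" using C by (simp add: P_def)
    moreover have "card I * card C + card I * card I' = card I * card I"
      using cle by (simp add: cI' distrib_left[symmetric])
    ultimately have "card I * card I' < card J'" using big by linarith
    moreover have "card I' \<le> card I * card I'" using cI' by (cases "card I") auto
    ultimately show ?thesis by (rule le_less_trans[rotated])
  qed
  then have "\<not> J' \<subseteq> g ` I'"
    using card_mono[of "g ` I'" J'] card_image_le[of I' g] fin by fastforce
  then obtain j0 where j0: "j0 \<in> J'" "j0 \<notin> g ` I'" by blast
  define r' where "r' i = (if i \<in> C then r i
     else (\<lambda>m. if m \<le> f i then r i m else q (g i) (h i + (m - f i))))" for i
  have untouched: "r i m \<noteq> q j k" if "i \<in> C" "j \<in> J'" for i m j k
  proof
    assume "r i m = q j k"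
    then have "q j k \<in> range (r i) \<inter> range (q j)" by (metis IntI rangeI)
    with that show False unfolding J'_def hit_def by blast
  qed
  have cases: "i \<in> C \<and> i \<notin> I' \<or> i \<in> I' \<and> i \<notin> C" if "i \<in> I" for i using that by (auto simp: I'_def)
  \<comment> \<open>The switch vertex lies on both rays and is counted as a vertex of
    \<open>q (g i)\<close>; hence the strict \<open>n < f i\<close>, which is the form that
    \<open>avoid\<close> needs.\<close>
  have vals: "(\<exists>n. r' i m = r i n \<and> (i \<in> I' \<longrightarrow> n < f i)) \<or>
      i \<in> I' \<and> (\<exists>k\<ge>h i. r' i m = q (g i) k)" if "i \<in> I" for i m
  proof (cases "i \<in> C")
    case True
    then show ?thesis by (auto simp: r'_def I'_def)
  next
    case False
    then have "i \<in> I'" using that by (simp add: I'_def)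
    show ?thesis
    proof (cases "m < f i")
      case True
      then show ?thesis using False by (auto simp: r'_def)
    next
      case not_less: False
      then have "r' i m = q (g i) (h i + (m - f i))"
        using False \<open>i \<in> I'\<close> gh[of i] by (cases "m = f i") (auto simp: r'_def)
      then show ?thesis using \<open>i \<in> I'\<close> le_add1 by blast
    qed
  qed
  show ?thesis
  proof (rule that[of j0 r'])
    show "j0 \<in> J" using j0 sub by blast
  next
    fix i assume i: "i \<in> I"
    show "directed_ray E (r' i)"
    proof (cases "i \<in> C")
      case True
      then show ?thesis using r i by (simp add: r'_def)
    next
      case False
      then have i': "i \<in> I'" using i by (simp add: I'_def)
      have "directed_ray E (\<lambda>m. if m \<le> f i then r i m else q (g i) (h i + (m - f i)))"
        using gh[OF i'] avoid[OF i' i'] sub by (intro directed_ray_switch r q i) auto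
      with False show ?thesis by (simp add: r'_def)
    qed
    show "r' i 0 = r i 0" by (simp add: r'_def)
    show "range (r' i) \<subseteq> (\<Union>i\<in>I. range (r i)) \<union> (\<Union>j\<in>J. range (q j))"
    proof
      fix v assume "v \<in> range (r' i)"
      then obtain m where "v = r' i m" by blast
      moreover have "g i \<in> J" if "i \<in> I'" using gh[OF that] sub by blast
      ultimately show "v \<in> (\<Union>i\<in>I. range (r i)) \<union> (\<Union>j\<in>J. range (q j))"
        using vals[OF i, of m] i by (auto; blast)
    qed
  next
    fix i m k assume i: "i \<in> I"
    show "r' i m \<noteq> q j0 k"
    proof
      assume e: "r' i m = q j0 k"
      from vals[OF i, of m] show False
      proof
        assume "\<exists>n. r' i m = r i n \<and> (i \<in> I' \<longrightarrow> n < f i)"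
        then obtain n where "r i n = q j0 k" "i \<in> I' \<longrightarrow> n < f i" using e by metis
        with cases[OF i] untouched j0 free[of i j0 n k] show False by auto
      next
        assume "i \<in> I' \<and> (\<exists>k\<ge>h i. r' i m = q (g i) k)"
        then obtain k' where "i \<in> I'" "q (g i) k' = q j0 k" using e by metis
        with disjoint_rangesD[OF qdisj, of "g i" j0] gh[of i] sub j0 show False by blast
      qed
    qed
  next
    have cross: False if a: "a \<in> I" "b \<in> I'" "r' a m = r a n" "a \<in> I' \<longrightarrow> n < f a"
      "k \<ge> h b" "r a n = q (g b) k" for a b m n k
      using cases[OF a(1)] untouched[of a "g b" n k] avoid[of a b n k] gh[of b] a by blast
    show "disjoint_ranges I r'"
      unfolding disjoint_ranges_def
    proof (intro ballI allI impI)
      fix a b m n assume a: "a \<in> I" and b: "b \<in> I" and e: "r' a m = r' b n"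
      from vals[OF a, of m] vals[OF b, of n] show "a = b"
      proof (elim disjE exE conjE)
        fix x y assume "r' a m = r a x" "r' b n = r b y"
        with e show ?thesis using disjoint_rangesD[OF rdisj a b] by metis
      next
        fix x y assume "r' a m = r a x" "a \<in> I' \<longrightarrow> x < f a" "b \<in> I'" "h b \<le> y" "r' b n = q (g b) y"
        with e cross[of a b m x y] a show ?thesis by metis
      next
        fix x y assume "r' b n = r b y" "b \<in> I' \<longrightarrow> y < f b" "a \<in> I'" "h a \<le> x" "r' a m = q (g a) x"
        with e cross[of b a n y x] b show ?thesis by metis
      next
        fix x y assume ab: "a \<in> I'" "b \<in> I'" "r' a m = q (g a) x" "r' b n = q (g b) y"
        with e have "q (g a) x = q (g b) y" by simp
        with ab gh sub have "g a = g b" using disjoint_rangesD[OF qdisj] by blast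
        then show ?thesis using inj_onD[OF ginj] ab by blast
      qed
    qed
  qed
qed

section \<open>Independent sets under bounded out-degree, by Ramsey's theorem\<close>

text \<open>Pairs are coloured by the direction of a conflict. In a homogeneous set of colour 1 the
  set \<open>N y0\<close> would contain all larger elements and be infinite; in one of colour 2 an
  element above \<open>d + 1\<close> others would have all of them in its \<open>N\<close>. Only
  colour 0, no conflict, remains.\<close>

lemma infinite_independent_set:
  fixes N :: "nat \<Rightarrow> nat set"
  assumes fin: "\<And>i. finite (N i)" and bound: "\<And>i. card (N i) \<le> d"
  obtains Y where "infinite Y" "\<And>i j. i \<in> Y \<Longrightarrow> j \<in> Y \<Longrightarrow> i \<noteq> j \<Longrightarrow> j \<notin> N i"
proof -
  define col :: "nat set \<Rightarrow> nat" where
    "col X = (if Max X \<in> N (Min X) then 1 else if Min X \<in> N (Max X) then 2 else 0)" for X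
  have "\<exists>Y t. Y \<subseteq> UNIV \<and> infinite Y \<and> t < 3 \<and> (\<forall>x\<in>Y. \<forall>y\<in>Y. x \<noteq> y \<longrightarrow> col {x, y} = t)"
    by (rule Ramsey2) (simp_all add: col_def)
  then obtain Y t where Y: "infinite Y"
    and "\<forall>x\<in>Y. \<forall>y\<in>Y. x \<noteq> y \<longrightarrow> col {x, y} = t" by (elim exE conjE)
  then have t: "col {x, y} = t" if "x \<in> Y" "y \<in> Y" "x \<noteq> y" for x y using that by blast
  have col: "col {x, y} = (if y \<in> N x then 1 else if x \<in> N y then 2 else 0)" if "x < y" for x y
    using that by (simp add: col_def)
  have col1: "y \<in> N x" if "x < y" "col {x, y} = 1" for x y
    using that(2) unfolding col[OF that(1)] by (simp split: if_split_asm)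
  have col2: "x \<in> N y" if "x < y" "col {x, y} = 2" for x y
    using that(2) unfolding col[OF that(1)] by (simp split: if_split_asm)
  have col0: "y \<notin> N x \<and> x \<notin> N y" if "x < y" "col {x, y} \<noteq> 1" "col {x, y} \<noteq> 2" for x y
    using that(2,3) unfolding col[OF that(1)] by (simp split: if_split_asm)
  have not1: "t \<noteq> 1"
  proof
    assume "t = 1"
    obtain y0 where y0: "y0 \<in> Y" using Y infinite_imp_nonempty by blast
    have "y \<in> N y0" if "y \<in> Y" "y0 < y" for y
      using col1[OF that(2)] t[OF y0 that(1)] that(2) \<open>t = 1\<close> by simp
    then have "Y \<subseteq> {..y0} \<union> N y0" using not_le by blast
    with Y fin show False using finite_subset[of Y "{..y0} \<union> N y0"] by simp
  qed
  have not2: "t \<noteq> 2"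
  proof
    assume "t = 2"
    obtain Z where Z: "finite Z" "card Z = Suc d" "Z \<subseteq> Y"
      using infinite_arbitrarily_large[OF Y] by blast
    obtain y where y: "y \<in> Y" "y > Max Z" using Y by (meson infinite_nat_iff_unbounded)
    have "z \<in> N y" if "z \<in> Z" for z
    proof -
      have "z < y" using y Z that by (meson Max_ge le_less_trans)
      then show ?thesis
        using col2[OF \<open>z < y\<close>] t[of z y] that y Z \<open>t = 2\<close> by blast
    qed
    then have "card Z \<le> card (N y)" using fin by (auto intro: card_mono)
    with Z bound[of y] show False by simp
  qed
  show ?thesis
  proof (rule that[OF Y])
    fix i j assume ij: "i \<in> Y" "j \<in> Y" "i \<noteq> j"
    then have c: "col {i, j} \<noteq> 1" "col {i, j} \<noteq> 2" using t not1 not2 by simp_all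
    show "j \<notin> N i"
    proof (cases "i < j")
      case True
      with c col0 show ?thesis by blast
    next
      case False
      with ij have "j < i" by simp
      with c col0[of j i] show ?thesis by (simp add: insert_commute)
    qed
  qed
qed

section \<open>Patterns that are eventually out-oriented\<close>

lemma pattern_copy_tail:
  assumes "\<And>n. l \<le> n \<Longrightarrow> \<sigma> n" and c: "pattern_copy \<sigma> E c"
  shows "directed_ray E (\<lambda>m. c (l + m))"
  unfolding pattern_copy_def
proof (intro conjI allI)
  show "inj (\<lambda>m. c (l + m))" by (rule injI) (simp add: pattern_copy_eq_iff[OF c])
  fix n
  have "(c (l + n), c (Suc (l + n))) \<in> E"
    using c assms(1)[of "l + n"] unfolding pattern_copy_def by (metis le_add1)
  then show "if True then (c (l + n), c (l + Suc n)) \<in> E else (c (l + Suc n), c (l + n)) \<in> E"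
    by simp
qed

lemma directed_ray_shift: "directed_ray E r \<Longrightarrow> directed_ray E (\<lambda>m. r (a + m))"
  using pattern_copy_tail[of a "\<lambda>_. True" E r] by simp

text \<open>Each vertex of \<open>U\<close> lies on at most one of the disjoint copies, so at most
  \<open>card U\<close> of the \<open>card U + n + 1\<close> copies are lost.\<close>

lemma disjoint_copies_avoiding:
  fixes U :: "'v set"
  assumes many: "\<And>K::nat. \<exists>c :: nat \<Rightarrow> nat \<Rightarrow> 'v.
      (\<forall>k<K. pattern_copy \<sigma> E (c k)) \<and> disjoint_ranges {..<K} c"
    and U: "finite U"
  obtains c and J :: "nat set" where "finite J" "card J > n" "disjoint_ranges J c"
    "\<And>j. j \<in> J \<Longrightarrow> pattern_copy \<sigma> E (c j)" "\<And>j m. j \<in> J \<Longrightarrow> c j m \<notin> U"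
proof -
  let ?K = "Suc (card U + n)"
  obtain c :: "nat \<Rightarrow> nat \<Rightarrow> 'v" where c: "\<And>k. k < ?K \<Longrightarrow> pattern_copy \<sigma> E (c k)"
    and disj: "disjoint_ranges {..<?K} c" using many[of ?K] by blast
  define J where "J = {k. k < ?K \<and> range (c k) \<inter> U = {}}"
  have "\<forall>k\<in>{..<?K} - J. \<exists>m. c k m \<in> U" unfolding J_def by blast
  from bchoice[OF this] obtain w where w: "\<And>k. k \<in> {..<?K} - J \<Longrightarrow> c k (w k) \<in> U" by blast
  have "inj_on (\<lambda>k. c k (w k)) ({..<?K} - J)"
    by (rule inj_onI) (use disjoint_rangesD[OF disj] in blast)
  then have "card ({..<?K} - J) \<le> card U"
    using w U by (intro card_inj_on_le[of "\<lambda>k. c k (w k)"]) auto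
  moreover have "J \<subseteq> {..<?K}" by (auto simp: J_def)
  then have "card ({..<?K} - J) = ?K - card J" "finite J"
    by (auto simp: card_Diff_subset finite_subset)
  ultimately have "card J > n" by simp
  show ?thesis
    by (rule that[OF \<open>finite J\<close> \<open>card J > n\<close> disjoint_ranges_subset[OF disj \<open>J \<subseteq> {..<?K}\<close>]])
      (use c in \<open>auto simp: J_def\<close>)
qed

text \<open>
  \<open>C i\<close> only matters through its first \<open>l + 1\<close> vertices, the finite part of the \<open>i\<close>-th copy; the ray
  \<open>T i\<close> continues it and is frozen up to position \<open>L\<close>. The frozen part of \<open>T i\<close> may meet the
  finite parts of copies chosen later.
\<close>

definition fixed_segments ::
    "(nat \<Rightarrow> bool) \<Rightarrow> ('v \<times> 'v) set \<Rightarrow> nat \<Rightarrow> nat \<Rightarrow> (nat \<Rightarrow> nat \<Rightarrow> 'v) \<Rightarrow> (nat \<Rightarrow> nat \<Rightarrow> 'v) \<Rightarrow> nat \<Rightarrow> bool" where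
  "fixed_segments \<sigma> E l n C T L \<longleftrightarrow>
     (\<forall>i<n. pattern_copy \<sigma> E (C i) \<and> directed_ray E (T i) \<and> T i 0 = C i l) \<and>
     disjoint_ranges {..<n} T \<and>
     (\<forall>i<n. \<forall>j<n. \<forall>a\<le>l. \<forall>b\<le>l. C i a = C j b \<longrightarrow> i = j) \<and>
     (\<forall>i<n. \<forall>m>0. T i m \<notin> C i ` {..l}) \<and>
     (\<forall>i<n. \<forall>j<n. \<forall>m\<ge>L. T i m \<notin> C j ` {..l})"

text \<open>Copies avoiding everything frozen so far are taken, and the tails of the
  \<open>T i\<close> from position \<open>L\<close> on are rerouted through the tails of these
  copies. The spared tail \<open>q j0\<close> becomes the new ray and its copy \<open>c j0\<close>
  the new copy. Rerouted tails use only old vertices from position \<open>L\<close> on and fresh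
  ones, so they miss the old finite parts.\<close>

lemma extend_fixed_segments:
  fixes C T :: "nat \<Rightarrow> nat \<Rightarrow> 'v"
  assumes tail: "\<And>m. l \<le> m \<Longrightarrow> \<sigma> m"
    and many: "\<And>K::nat. \<exists>c :: nat \<Rightarrow> nat \<Rightarrow> 'v.
      (\<forall>k<K. pattern_copy \<sigma> E (c k)) \<and> disjoint_ranges {..<K} c"
    and C: "\<And>i. i < n \<Longrightarrow> pattern_copy \<sigma> E (C i)"
    and T: "\<And>i. i < n \<Longrightarrow> directed_ray E (T i)" and T0: "\<And>i. i < n \<Longrightarrow> T i 0 = C i l"
    and Tdisj: "disjoint_ranges {..<n} T"
    and Cdisj: "\<And>i j a b. \<lbrakk>i < n; j < n; a \<le> l; b \<le> l; C i a = C j b\<rbrakk> \<Longrightarrow> i = j"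
    and own: "\<And>i m. i < n \<Longrightarrow> 0 < m \<Longrightarrow> T i m \<notin> C i ` {..l}"
    and late: "\<And>i j m. \<lbrakk>i < n; j < n; L \<le> m\<rbrakk> \<Longrightarrow> T i m \<notin> C j ` {..l}"
  obtains c T' L' where "L < L'"
    "\<And>i m. i < n \<Longrightarrow> m \<le> L \<Longrightarrow> T' i m = T i m"
    "\<And>i. i < Suc n \<Longrightarrow> pattern_copy \<sigma> E ((C(n := c)) i)"
    "\<And>i. i < Suc n \<Longrightarrow> directed_ray E (T' i)"
    "\<And>i. i < Suc n \<Longrightarrow> T' i 0 = (C(n := c)) i l"
    "disjoint_ranges {..<Suc n} T'"
    "\<And>i j a b. \<lbrakk>i < Suc n; j < Suc n; a \<le> l; b \<le> l; (C(n := c)) i a = (C(n := c)) j b\<rbrakk> \<Longrightarrow> i = j"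
    "\<And>i m. i < Suc n \<Longrightarrow> 0 < m \<Longrightarrow> T' i m \<notin> (C(n := c)) i ` {..l}"
    "\<And>i j m. \<lbrakk>i < Suc n; j < Suc n; L' \<le> m\<rbrakk> \<Longrightarrow> T' i m \<notin> (C(n := c)) j ` {..l}"
proof -
  define U where "U = (\<Union>i<n. C i ` {..l} \<union> T i ` {..L})"
  have "finite U" by (simp add: U_def)
  then obtain c and J :: "nat set" where J: "finite J" "card J > n * n" and cdisj: "disjoint_ranges J c"
    and c: "\<And>j. j \<in> J \<Longrightarrow> pattern_copy \<sigma> E (c j)" and cU: "\<And>j m. j \<in> J \<Longrightarrow> c j m \<notin> U"
    by (rule disjoint_copies_avoiding[OF many]) blast
  define q where "q = (\<lambda>j m. c j (l + m))"
  define r where "r = (\<lambda>i m. T i (L + m))"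
  have q: "directed_ray E (q j)" if "j \<in> J" for j
    using pattern_copy_tail[of l \<sigma> E "c j"] tail c[OF that] by (simp add: q_def)
  have r: "directed_ray E (r i)" if "i \<in> {..<n}" for i
    using directed_ray_shift[OF T] that by (simp add: r_def)
  have rdisj: "disjoint_ranges {..<n} r"
    using Tdisj unfolding disjoint_ranges_def r_def by blast
  have qdisj: "disjoint_ranges J q"
    using cdisj unfolding disjoint_ranges_def q_def by blast
  have big: "card {..<n} * card {..<n} < card J" using J by simp
  obtain r' j0 where j0: "j0 \<in> J" and r': "\<And>i. i \<in> {..<n} \<Longrightarrow> directed_ray E (r' i)"
    and r'0: "\<And>i. i \<in> {..<n} \<Longrightarrow> r' i 0 = r i 0" and r'disj: "disjoint_ranges {..<n} r'"
    and r'q: "\<And>i m k. i \<in> {..<n} \<Longrightarrow> r' i m \<noteq> q j0 k"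
    and r'range: "\<And>i. i \<in> {..<n} \<Longrightarrow> range (r' i) \<subseteq> (\<Union>i\<in>{..<n}. range (r i)) \<union> (\<Union>j\<in>J. range (q j))"
    by (rule directed_rays_extend_by_one[OF finite_lessThan J(1) big r rdisj q qdisj])
      (assumption, assumption, (rule that; simp))
  have r'val: "(\<exists>x y. x < n \<and> r' i k = T x (L + y)) \<or> r' i k \<notin> U" if "i < n" for i k
  proof -
    have "r' i k \<in> (\<Union>i\<in>{..<n}. range (r i)) \<union> (\<Union>j\<in>J. range (q j))"
      using r'range[of i] that by blast
    then show ?thesis
    proof
      assume "r' i k \<in> (\<Union>i\<in>{..<n}. range (r i))"
      then show ?thesis by (auto simp: r_def)
    next
      assume "r' i k \<in> (\<Union>j\<in>J. range (q j))"
      then obtain j m where "j \<in> J" "r' i k = c j (l + m)" by (auto simp: q_def)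
      then show ?thesis using cU by simp
    qed
  qed
  have TU: "T i m \<in> U" if "i < n" "m \<le> L" for i m using that by (auto simp: U_def)
  have CU: "C i a \<in> U" if "i < n" "a \<le> l" for i a using that by (auto simp: U_def)
  have r'C: "r' i k \<notin> C j ` {..l}" if "i < n" "j < n" for i j k
  proof
    assume "r' i k \<in> C j ` {..l}"
    with r'val[OF that(1), of k] CU[OF that(2)] late[OF _ that(2)] show False
      by (metis atMost_iff imageE le_add1)
  qed
  have r'T: "x = i \<and> m = L" if h: "i < n" "x < n" "m \<le> L" "T x m = r' i k" for i k x m
  proof -
    obtain x' y where x': "x' < n" "r' i k = T x' (L + y)"
      using r'val[OF h(1), of k] TU[OF h(2,3)] h(4) by auto
    with h have e: "T x m = T x' (L + y)" by simp
    then have "x = x'" using disjoint_rangesD[OF Tdisj _ _ e] h x' by simp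
    with e have "m = L" using T[OF h(2)] h(3) by (simp add: pattern_copy_eq_iff)
    with h r'0[of x] have "r' x 0 = r' i k" by (simp add: r_def)
    then have "x = i" using disjoint_rangesD[OF r'disj, of x i 0 k] h by simp
    with \<open>m = L\<close> show ?thesis by simp
  qed
  \<comment> \<open>The summand \<open>0\<close> gives the form of
    \<open>directed_ray_switch\<close> with entry position 0 on \<open>r' i\<close>.\<close>
  define T' where "T' i = (if i = n then q j0 else (\<lambda>m. if m \<le> L then T i m else r' i (0 + (m - L))))" for i
  have T'old: "T' i m = (if m \<le> L then T i m else r' i (m - L))" if "i < n" for i m
    using that by (simp add: T'_def)
  have T'new: "T' n = q j0" by (simp add: T'_def)
  define C' where "C' = C(n := c j0)"
  have C'old: "C' i = C i" if "i < n" for i using that by (simp add: C'_def)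
  have C'new: "C' n = c j0" by (simp add: C'_def)
  have T': "directed_ray E (T' i)" if "i < Suc n" for i
  proof (cases "i = n")
    case True
    then show ?thesis using q[OF j0] T'new by simp
  next
    case False
    then have i: "i < n" using that by simp
    have "directed_ray E (\<lambda>m. if m \<le> L then T i m else r' i (0 + (m - L)))"
    proof (rule directed_ray_switch)
      show "directed_ray E (T i)" "directed_ray E (r' i)" using T r' i by simp_all
      show "T i L = r' i 0" using r'0[of i] i by (simp add: r_def)
      show "T i m \<noteq> r' i k" if "m < L" for m k using r'T[OF i i, of m k] that by auto
    qed
    with False show ?thesis by (simp add: T'_def)
  qed
  have qC: "q j0 m \<noteq> C j a" if "j < n" "a \<le> l" for m j a
    using cU[OF j0, of "l + m"] CU[OF that] by (auto simp: q_def)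
  have T'q: "T' i m \<noteq> q j0 k" if "i < n" for i m k
    using r'q[of i] TU[OF that, of m] cU[OF j0, of "l + k"] that by (auto simp: T'old q_def)
  \<comment> \<open>The rerouted rays may run through the finite part of the new copy, but each is
    injective and the finite parts are finite, so all such visits end at some position.\<close>
  have "\<exists>L'>L. \<forall>i<Suc n. \<forall>j<Suc n. \<forall>m\<ge>L'. T' i m \<notin> C' j ` {..l}"
  proof -
    let ?W = "\<Union>j<Suc n. C' j ` {..l}"
    let ?B = "\<Union>i<Suc n. T' i -` ?W"
    have "finite ?B"
      using T' by (intro finite_UN_I finite_vimageI) (auto simp: pattern_copy_def)
    then obtain B where B: "\<And>m. m \<in> ?B \<Longrightarrow> m < B"
      by (meson finite_nat_set_iff_bounded)
    have "T' i m \<notin> C' j ` {..l}" if "i < Suc n" "j < Suc n" "max B (Suc L) \<le> m" for i j m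
      using B[of m] that by fastforce
    then show ?thesis by (intro exI[of _ "max B (Suc L)"]) auto
  qed
  then obtain L' where L': "L < L'" and late': "\<And>i j m. \<lbrakk>i < Suc n; j < Suc n; L' \<le> m\<rbrakk> \<Longrightarrow> T' i m \<notin> C' j ` {..l}"
    by blast
  show ?thesis
  proof (rule that[of L' T' "c j0", folded C'_def])
    show "L < L'" by fact
    show "T' i m = T i m" if "i < n" "m \<le> L" for i m using that by (simp add: T'old)
    show "pattern_copy \<sigma> E (C' i)" if "i < Suc n" for i
      using that C c[OF j0] by (auto simp: C'old C'new less_Suc_eq)
    show "directed_ray E (T' i)" if "i < Suc n" for i by (rule T'[OF that])
    show "T' i 0 = C' i l" if "i < Suc n" for i
      using that T0 by (auto simp: T'old T'new C'old C'new q_def less_Suc_eq)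
    show "disjoint_ranges {..<Suc n} T'"
      unfolding disjoint_ranges_def
    proof (intro ballI allI impI)
      fix i j m k assume ij: "i \<in> {..<Suc n}" "j \<in> {..<Suc n}" and e: "T' i m = T' j k"
      consider "i = n" "j = n" | "i < n" "j = n" | "i = n" "j < n" | "i < n" "j < n"
        using ij by (auto simp: less_Suc_eq)
      then show "i = j"
      proof cases
        case 2
        with e T'q T'new show ?thesis by metis
      next
        case 3
        with e T'q T'new show ?thesis by metis
      next
        case 4
        show ?thesis
        proof (cases "m \<le> L"; cases "k \<le> L")
          assume "m \<le> L" "k \<le> L"
          then show ?thesis using e 4 disjoint_rangesD[OF Tdisj, of i j m k] by (simp add: T'old)
        next
          assume "m \<le> L" "\<not> k \<le> L"
          then show ?thesis using e 4 r'T[of j i m "k - L"] by (simp add: T'old)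
        next
          assume "\<not> m \<le> L" "k \<le> L"
          then show ?thesis using e 4 r'T[of i j k "m - L"] by (simp add: T'old)
        next
          assume "\<not> m \<le> L" "\<not> k \<le> L"
          then show ?thesis using e 4 disjoint_rangesD[OF r'disj, of i j "m - L" "k - L"] by (simp add: T'old)
        qed
      qed simp
    qed
    show "i = j" if h: "i < Suc n" "j < Suc n" "a \<le> l" "b \<le> l" "C' i a = C' j b" for i j a b
    proof -
      consider "i = n" "j = n" | "i < n" "j = n" | "i = n" "j < n" | "i < n" "j < n"
        using h by (auto simp: less_Suc_eq)
      then show "i = j"
      proof cases
        case 2
        with h cU[OF j0, of b] CU[of i a] show ?thesis by (simp add: C'old C'new)
      next
        case 3
        with h cU[OF j0, of a] CU[of j b] show ?thesis by (simp add: C'old C'new)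
      next
        case 4
        with h Cdisj show ?thesis by (simp add: C'old)
      qed simp
    qed
    show "T' i m \<notin> C' i ` {..l}" if "i < Suc n" "0 < m" for i m
    proof (cases "i = n")
      case True
      with that show ?thesis
        by (auto simp: T'new C'new q_def pattern_copy_eq_iff[OF c[OF j0]])
    next
      case False
      then have i: "i < n" using that by simp
      with own[OF i that(2)] r'C[OF i i] show ?thesis by (simp add: T'old C'old)
    qed
    show "T' i m \<notin> C' j ` {..l}" if "i < Suc n" "j < Suc n" "L' \<le> m" for i j m
      by (rule late'[OF that])
  qed
qed

text \<open>The extension in the existential form that dependent choice asks for.\<close>

lemma fixed_segments_Suc:
  fixes C T :: "nat \<Rightarrow> nat \<Rightarrow> 'v"
  assumes tail: "\<And>m. l \<le> m \<Longrightarrow> \<sigma> m"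
    and many: "\<And>K::nat. \<exists>c :: nat \<Rightarrow> nat \<Rightarrow> 'v.
      (\<forall>k<K. pattern_copy \<sigma> E (c k)) \<and> disjoint_ranges {..<K} c"
    and v: "fixed_segments \<sigma> E l n C T L"
  shows "\<exists>C' T' L'. fixed_segments \<sigma> E l (Suc n) C' T' L' \<and> L < L' \<and>
    (\<forall>i<n. C' i = C i \<and> (\<forall>m\<le>L. T' i m = T i m))"
proof -
  have v': "\<And>i. i < n \<Longrightarrow> pattern_copy \<sigma> E (C i)" "\<And>i. i < n \<Longrightarrow> directed_ray E (T i)"
    "\<And>i. i < n \<Longrightarrow> T i 0 = C i l" "disjoint_ranges {..<n} T"
    "\<And>i j a b. \<lbrakk>i < n; j < n; a \<le> l; b \<le> l; C i a = C j b\<rbrakk> \<Longrightarrow> i = j"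
    "\<And>i m. i < n \<Longrightarrow> 0 < m \<Longrightarrow> T i m \<notin> C i ` {..l}"
    "\<And>i j m. \<lbrakk>i < n; j < n; L \<le> m\<rbrakk> \<Longrightarrow> T i m \<notin> C j ` {..l}"
  proof -
    from v[unfolded fixed_segments_def]
    have v1: "\<forall>i<n. pattern_copy \<sigma> E (C i) \<and> directed_ray E (T i) \<and> T i 0 = C i l"
      and v2: "disjoint_ranges {..<n} T"
      and v3: "\<forall>i<n. \<forall>j<n. \<forall>a\<le>l. \<forall>b\<le>l. C i a = C j b \<longrightarrow> i = j"
      and v4: "\<forall>i<n. \<forall>m>0. T i m \<notin> C i ` {..l}"
      and v5: "\<forall>i<n. \<forall>j<n. \<forall>m\<ge>L. T i m \<notin> C j ` {..l}"
      by - (elim conjE, assumption)+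
    show "pattern_copy \<sigma> E (C i)" "directed_ray E (T i)" "T i 0 = C i l" if "i < n" for i
      using v1 that by simp_all
    show "disjoint_ranges {..<n} T" by (rule v2)
    show "i = j" if "i < n" "j < n" "a \<le> l" "b \<le> l" "C i a = C j b" for i j a b
      using v3 that by simp
    show "T i m \<notin> C i ` {..l}" if "i < n" "0 < m" for i m using v4 that by simp
    show "T i m \<notin> C j ` {..l}" if "i < n" "j < n" "L \<le> m" for i j m using v5 that by simp
  qed
  show ?thesis
  proof (rule extend_fixed_segments[of l \<sigma> E n C T L])
    fix L' T' and c :: "nat \<Rightarrow> 'v"
    assume h: "L < L'" "\<And>i m. i < n \<Longrightarrow> m \<le> L \<Longrightarrow> T' i m = T i m"
      "\<And>i. i < Suc n \<Longrightarrow> pattern_copy \<sigma> E ((C(n := c)) i)"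
      "\<And>i. i < Suc n \<Longrightarrow> directed_ray E (T' i)"
      "\<And>i. i < Suc n \<Longrightarrow> T' i 0 = (C(n := c)) i l"
      "disjoint_ranges {..<Suc n} T'"
      "\<And>i j a b. \<lbrakk>i < Suc n; j < Suc n; a \<le> l; b \<le> l; (C(n := c)) i a = (C(n := c)) j b\<rbrakk> \<Longrightarrow> i = j"
      "\<And>i m. i < Suc n \<Longrightarrow> 0 < m \<Longrightarrow> T' i m \<notin> (C(n := c)) i ` {..l}"
      "\<And>i j m. \<lbrakk>i < Suc n; j < Suc n; L' \<le> m\<rbrakk> \<Longrightarrow> T' i m \<notin> (C(n := c)) j ` {..l}"
    have "fixed_segments \<sigma> E l (Suc n) (C(n := c)) T' L'"
      unfolding fixed_segments_def by (intro conjI allI impI h(3-); assumption)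
    moreover have "\<forall>i<n. (C(n := c)) i = C i \<and> (\<forall>m\<le>L. T' i m = T i m)" using h(2) by simp
    ultimately show ?thesis using h(1) by blast
  qed (fact tail many v')+
qed

text \<open>Since \<open>L\<close> grows, each vertex of the constructed rays stabilises, and the
  limits are disjoint rays \<open>S i\<close> starting at the ends of disjoint finite parts of
  copies \<open>D i\<close>. A limit ray can still meet a foreign finite part, but such a part has
  \<open>l + 1\<close> vertices, each on at most one ray, so an infinite conflict-free set of
  indices exists.\<close>

lemma out_tail_infinitely_many:
  fixes E :: "('v \<times> 'v) set"
  assumes tail: "\<And>m. l \<le> m \<Longrightarrow> \<sigma> m"
    and many: "\<And>K::nat. \<exists>c :: nat \<Rightarrow> nat \<Rightarrow> 'v.
      (\<forall>k<K. pattern_copy \<sigma> E (c k)) \<and> disjoint_ranges {..<K} c"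
  shows "\<exists>c :: nat \<Rightarrow> nat \<Rightarrow> 'v. (\<forall>i. pattern_copy \<sigma> E (c i)) \<and> disjoint_ranges UNIV c"
proof -
  define P where "P n s = (case s of (C, T, L) \<Rightarrow> fixed_segments \<sigma> E l n C T L)" for n s
  define Q where "Q n s s' = (case s of (C, T, L) \<Rightarrow> case s' of (C', T', L') \<Rightarrow>
      L < L' \<and> (\<forall>i<n. C' i = C i \<and> (\<forall>m\<le>L. T' i m = T i m)))"
    for n :: nat and s s' :: "(nat \<Rightarrow> nat \<Rightarrow> 'v) \<times> (nat \<Rightarrow> nat \<Rightarrow> 'v) \<times> nat"
  have "\<exists>f. \<forall>n. P n (f n) \<and> Q n (f n) (f (Suc n))"
  proof (rule dependent_nat_choice)
    \<comment> \<open>With no ray present every condition is vacuous, so the families are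
      arbitrary.\<close>
    have "P 0 (undefined, undefined, 0)"
      by (simp add: P_def fixed_segments_def disjoint_ranges_def)
    then show "\<exists>s. P 0 s" by blast
    fix s n assume s: "P n s"
    obtain C T L where "s = (C, T, L)" by (cases s) auto
    with s fixed_segments_Suc[of l \<sigma> E n C T L] tail many
    show "\<exists>s'. P (Suc n) s' \<and> Q n s s'" by (auto simp: P_def Q_def)
  qed
  then obtain f where f: "\<And>n. P n (f n)" "\<And>n. Q n (f n) (f (Suc n))" by blast
  define C T L where "C n = fst (f n)" and "T n = fst (snd (f n))" and "L n = snd (snd (f n))" for n
  have v: "fixed_segments \<sigma> E l n (C n) (T n) (L n)" for n
    using f(1)[of n] by (simp add: P_def C_def T_def L_def case_prod_beta)
  have step: "L n < L (Suc n)" "\<And>i. i < n \<Longrightarrow> C (Suc n) i = C n i"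
    "\<And>i m. i < n \<Longrightarrow> m \<le> L n \<Longrightarrow> T (Suc n) i m = T n i m" for n
    using f(2)[of n] by (auto simp: Q_def C_def T_def L_def case_prod_beta)
  have Lge: "n \<le> L n" for n
  proof (induction n)
    case (Suc n)
    then show ?case using step(1)[of n] by linarith
  qed simp
  have Lmono: "L n \<le> L n'" if "n \<le> n'" for n n'
    by (rule lift_Suc_mono_le[of L, OF less_imp_le[OF step(1)] that])
  have keepC: "C n' i = C n i" if "i < n" "n \<le> n'" for i n n'
    using that(2) by (induction rule: dec_induct) (use that(1) step(2) in auto)
  have keepT: "T n' i m = T n i m" if "i < n" "m \<le> L n" "n \<le> n'" for i m n n'
    using that(3)
  proof (induction rule: dec_induct)
    case (step k)
    have "m \<le> L k" using that(2) Lmono[OF step(1)] by simp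
    then show ?case using step that(1) \<open>\<And>n i m. \<lbrakk>i < n; m \<le> L n\<rbrakk> \<Longrightarrow> T (Suc n) i m = T n i m\<close> by simp
  qed simp
  define D where "D i = C (Suc i) i" for i
  \<comment> \<open>At stage \<open>Suc (i + m)\<close> the \<open>i\<close>-th ray is present and,
    as \<open>n \<le> L n\<close>, frozen beyond position \<open>m\<close>.\<close>
  define S where "S i m = T (Suc (i + m)) i m" for i m
  have D: "D i = C n i" if "i < n" for i n using keepC[of i "Suc i" n] that by (simp add: D_def)
  have S: "S i m = T n i m" if "i < n" "m \<le> n" for i m n
  proof -
    let ?N = "max n (Suc (i + m))"
    have "m \<le> L n" "m \<le> L (Suc (i + m))" using Lge[of n] Lge[of "Suc (i + m)"] that by linarith+
    then have "T ?N i m = T n i m" "T ?N i m = T (Suc (i + m)) i m"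
      using that by (auto intro: keepT)
    then show ?thesis by (simp add: S_def)
  qed
  have Sray: "directed_ray E (S i)" for i
    unfolding pattern_copy_def
  proof (intro conjI allI)
    have r: "directed_ray E (T n i)" if "i < n" for n
      using v that by (simp add: fixed_segments_def)
    show "inj (S i)"
    proof (rule injI)
      fix a b assume "S i a = S i b"
      then have "T (Suc (i + a + b)) i a = T (Suc (i + a + b)) i b"
        using S[of i "Suc (i + a + b)" a] S[of i "Suc (i + a + b)" b] by simp
      then show "a = b" using pattern_copy_eq_iff[OF r] by simp
    qed
    fix m
    have "(T (Suc (i + m)) i m, T (Suc (i + m)) i (Suc m)) \<in> E"
      using r[of "Suc (i + m)"] by (simp add: pattern_copy_def)
    then show "if True then (S i m, S i (Suc m)) \<in> E else (S i (Suc m), S i m) \<in> E"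
      using S[of i "Suc (i + m)" m] S[of i "Suc (i + m)" "Suc m"] by simp
  qed
  have S0: "S i 0 = D i l" for i
    using v[of "Suc i"] by (simp add: S_def D_def fixed_segments_def)
  have Sdisj: "i = j" if "S i a = S j b" for i j a b
  proof -
    let ?n = "Suc (i + j + a + b)"
    have "T ?n i a = T ?n j b" using that S[of i ?n a] S[of j ?n b] by simp
    then show ?thesis using v[of ?n] disjoint_rangesD[of "{..<?n}" "T ?n" i j a b]
      by (simp add: fixed_segments_def)
  qed
  have Dcopy: "pattern_copy \<sigma> E (D i)" for i
    using v[of "Suc i"] by (simp add: D_def fixed_segments_def)
  have Ddisj: "i = j" if "D i a = D j b" "a \<le> l" "b \<le> l" for i j a b
  proof -
    let ?n = "Suc (i + j)"
    have "C ?n i a = C ?n j b" using that D[of i ?n] D[of j ?n] by simp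
    moreover have "\<forall>i<?n. \<forall>j<?n. \<forall>a\<le>l. \<forall>b\<le>l. C ?n i a = C ?n j b \<longrightarrow> i = j"
      using v[of ?n, unfolded fixed_segments_def] by (elim conjE)
    ultimately show ?thesis using that by simp
  qed
  have own: "S i m \<noteq> D i a" if "0 < m" "a \<le> l" for i m a
  proof -
    have "T (Suc (i + m)) i m \<notin> C (Suc (i + m)) i ` {..l}"
      using v[of "Suc (i + m)"] that unfolding fixed_segments_def by simp
    then show ?thesis using that D[of i "Suc (i + m)"] by (auto simp: S_def)
  qed
  \<comment> \<open>The rays meeting the finite part of copy \<open>i\<close>. Among them is
    \<open>S i\<close> itself, because \<open>S i 0 = D i l\<close>; independence only concerns
    distinct indices.\<close>
  define N where "N i = {j. \<exists>a\<le>l. \<exists>m. S j m = D i a}" for i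
  define owner where "owner v = (THE j. \<exists>m. S j m = v)" for v
  have "owner (S j m) = j" for j m
    unfolding owner_def by (rule the_equality) (use Sdisj in blast)+
  then have Nsub: "N i \<subseteq> (\<lambda>a. owner (D i a)) ` {..l}" for i
    unfolding N_def by (smt (verit) atMost_iff image_iff mem_Collect_eq subsetI)
  have N: "finite (N i)" "card (N i) \<le> Suc l" for i
    using finite_subset[OF Nsub] card_mono[OF _ Nsub, of i] card_image_le[of "{..l}" "\<lambda>a. owner (D i a)"]
    by simp_all
  obtain Y where Y: "infinite Y" and indep: "\<And>i j. \<lbrakk>i \<in> Y; j \<in> Y; i \<noteq> j\<rbrakk> \<Longrightarrow> j \<notin> N i"
    by (rule infinite_independent_set[of N, OF N]) blast
  \<comment> \<open>Vertex \<open>l\<close> is taken from \<open>S i\<close>, where it equals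
    \<open>D i l\<close>; so the arc into it is still an arc of the copy.\<close>
  define X where "X i m = (if m < l then D i m else S i (m - l))" for i m
  have Xcopy: "pattern_copy \<sigma> E (X i)" for i
    unfolding pattern_copy_def
  proof (intro conjI allI)
    have XD: "X i m = D i m" if "m \<le> l" for m using that S0 by (auto simp: X_def)
    have XS: "X i m = S i (m - l)" if "l \<le> m" for m using that by (auto simp: X_def)
    show "inj (X i)"
    proof (rule injI)
      fix a b assume e: "X i a = X i b"
      consider "a \<le> l" "b \<le> l" | "a < l" "l < b" | "l < a" "b < l" | "l \<le> a" "l \<le> b" by linarith
      then show "a = b"
      proof cases
        case 1
        then show ?thesis using e XD pattern_copy_eq_iff[OF Dcopy] by simp
      next
        case 2
        then show ?thesis using e XD[of a] XS[of b] own[of "b - l" a i] by simp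
      next
        case 3
        then show ?thesis using e XD[of b] XS[of a] own[of "a - l" b i] by simp
      next
        case 4
        then have "a - l = b - l" using e XS pattern_copy_eq_iff[OF Sray, of i] by simp
        with 4 show ?thesis by simp
      qed
    qed
    fix m
    show "if \<sigma> m then (X i m, X i (Suc m)) \<in> E else (X i (Suc m), X i m) \<in> E"
    proof (cases "m < l")
      case True
      then have "X i m = D i m" "X i (Suc m) = D i (Suc m)" using XD by auto
      then show ?thesis using Dcopy[of i] by (simp add: pattern_copy_def)
    next
      case False
      then have "X i m = S i (m - l)" "X i (Suc m) = S i (Suc (m - l))"
        using XS[of m] XS[of "Suc m"] by (auto simp: Suc_diff_le)
      then show ?thesis using Sray[of i] tail[of m] False by (simp add: pattern_copy_def)
    qed
  qed
  have Xdisj: "disjoint_ranges Y X"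
    unfolding disjoint_ranges_def
  proof (intro ballI allI impI)
    fix i j a b assume ij: "i \<in> Y" "j \<in> Y" and e: "X i a = X j b"
    consider "a < l" "b < l" | "a < l" "l \<le> b" | "l \<le> a" "b < l" | "l \<le> a" "l \<le> b" by linarith
    then show "i = j"
    proof cases
      case 1
      then show ?thesis using e Ddisj[of i a j b] by (simp add: X_def)
    next
      case 2
      then have "a \<le> l" "S j (b - l) = D i a" using e by (auto simp: X_def)
      then have "j \<in> N i" unfolding N_def by blast
      then show ?thesis using indep ij by blast
    next
      case 3
      then have "b \<le> l" "S i (a - l) = D j b" using e by (auto simp: X_def)
      then have "i \<in> N j" unfolding N_def by blast
      then show ?thesis using indep[of j i] ij by blast
    next
      case 4
      then show ?thesis using e Sdisj by (simp add: X_def)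
    qed
  qed
  have "disjoint_ranges UNIV (\<lambda>k. X (enumerate Y k))"
    unfolding disjoint_ranges_def
  proof (intro ballI allI impI)
    fix i j a b assume "X (enumerate Y i) a = X (enumerate Y j) b"
    then have "enumerate Y i = enumerate Y j"
      using disjoint_rangesD[OF Xdisj] enumerate_in_set[OF Y] by blast
    then show "i = j" using inj_enumerate[OF Y] by (simp add: inj_eq)
  qed
  then show ?thesis
    by (intro exI[of _ "\<lambda>k. X (enumerate Y k)"] conjI allI Xcopy)
qed

section \<open>Patterns with infinitely many arcs of both orientations\<close>

text \<open>
  The \<open>f\<close>-th crossing point lies at position \<open>z f\<close> of the ray \<open>r f\<close>; the points \<open>2 * e\<close> (a local
  source) and \<open>2 * e + 1\<close> (a local sink) are identified, and represented by the former. The growth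
  condition makes a walk that starts at time \<open>n\<close> and position \<open>p\<close> of a ray and has agreed with its
  pattern up to the next crossing agree there as well.
\<close>

locale crossing_rays =
  fixes \<sigma> :: "nat \<Rightarrow> bool" and I :: "'r set" and r :: "nat \<Rightarrow> 'r" and z :: "nat \<Rightarrow> nat"
  assumes mono: "strict_mono z"
    and turn: "0 < z f" "\<sigma> (z f) \<longleftrightarrow> even f" "\<sigma> (z f - 1) \<longleftrightarrow> odd f"
    and growth: "\<lbrakk>n \<le> Suc f * Suc (z f); p \<le> Suc f * Suc (z f); \<sigma> (p + i) \<noteq> \<sigma> (n + i)\<rbrakk>
      \<Longrightarrow> \<exists>j. p + j < z (Suc f) \<and> \<sigma> (p + j) \<noteq> \<sigma> (n + j)"
    and cross_ne: "r (2 * e) \<noteq> r (Suc (2 * e))"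
    and often: "a \<in> I \<Longrightarrow> infinite {f. r f = a}"
begin

lemma z_eq_iff: "z f = z g \<longleftrightarrow> f = g"
  using mono by (simp add: strict_mono_eq)

text \<open>The quotient is encoded by normal forms: only the sink of a crossing is renamed.
  Injectivity of \<open>z\<close> makes the \<open>e\<close> under \<open>THE\<close> unique and
  keeps different crossings apart.\<close>

definition vert :: "'r \<Rightarrow> nat \<Rightarrow> 'r \<times> nat" where
  "vert a p = (if \<exists>e. p = z (Suc (2 * e)) \<and> a = r (Suc (2 * e))
     then let e = THE e. p = z (Suc (2 * e)) in (r (2 * e), z (2 * e)) else (a, p))"

lemma vert_cross: "vert (r (Suc (2 * e))) (z (Suc (2 * e))) = (r (2 * e), z (2 * e))"
proof -
  have "(THE e'. z (Suc (2 * e)) = z (Suc (2 * e'))) = e"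
    by (rule the_equality) (auto simp: z_eq_iff)
  then show ?thesis unfolding vert_def by (auto simp: Let_def)
qed

lemma vert_else: "\<nexists>e. p = z (Suc (2 * e)) \<and> a = r (Suc (2 * e)) \<Longrightarrow> vert a p = (a, p)"
  unfolding vert_def by (rule if_not_P)

definition partner :: "nat \<Rightarrow> nat" where
  "partner f = (if even f then Suc f else f - 1)"

lemma even_partner [simp]: "even (partner f) \<longleftrightarrow> odd f"
  by (auto simp: partner_def)

lemma partner_le: "partner f \<le> Suc (2 * e) \<longleftrightarrow> f \<le> Suc (2 * e)"
  by (auto simp: partner_def elim!: evenE oddE)

lemma vert_eq:
  assumes "vert a p = vert b q"
  shows "a = b \<and> p = q \<or> (\<exists>f. a = r f \<and> p = z f \<and> b = r (partner f) \<and> q = z (partner f))"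
proof (cases "\<exists>e. p = z (Suc (2 * e)) \<and> a = r (Suc (2 * e))")
  case True
  then obtain e where e: "p = z (Suc (2 * e))" "a = r (Suc (2 * e))" by blast
  show ?thesis
  proof (cases "\<exists>e. q = z (Suc (2 * e)) \<and> b = r (Suc (2 * e))")
    case True
    then obtain e' where e': "q = z (Suc (2 * e'))" "b = r (Suc (2 * e'))" by blast
    with e assms have "e = e'" by (simp add: vert_cross z_eq_iff)
    with e e' show ?thesis by simp
  next
    case False
    with e assms have "b = r (2 * e)" "q = z (2 * e)" by (simp_all add: vert_cross vert_else)
    with e show ?thesis by (intro disjI2 exI[of _ "Suc (2 * e)"]) (simp add: partner_def)
  qed
next
  case False
  show ?thesis
  proof (cases "\<exists>e. q = z (Suc (2 * e)) \<and> b = r (Suc (2 * e))")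
    case True
    then obtain e where e: "q = z (Suc (2 * e))" "b = r (Suc (2 * e))" by blast
    with False assms have "a = r (2 * e)" "p = z (2 * e)" by (simp_all add: vert_cross vert_else)
    with e show ?thesis by (intro disjI2 exI[of _ "2 * e"]) (simp add: partner_def)
  next
    case False': False
    with False assms show ?thesis by (simp add: vert_else)
  qed
qed

lemma vert_crossing: "vert (r (Suc (2 * e))) (z (Suc (2 * e))) = vert (r (2 * e)) (z (2 * e))"
proof -
  have "\<nexists>e'. z (2 * e) = z (Suc (2 * e')) \<and> r (2 * e) = r (Suc (2 * e'))"
    by (simp add: z_eq_iff) presburger
  then show ?thesis by (simp add: vert_cross vert_else)
qed

lemma r_partner: "r (partner f) \<noteq> r f"
proof (cases "even f")
  case True
  then obtain e where "f = 2 * e" by (elim evenE)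
  then show ?thesis using cross_ne[of e] by (simp add: partner_def)
next
  case False
  then obtain e where "f = Suc (2 * e)" by (elim oddE) simp
  then show ?thesis using cross_ne[of e] by (simp add: partner_def)
qed

lemma vert_same_ray: "vert a p = vert a q \<longleftrightarrow> p = q"
  by (metis vert_eq r_partner)

definition crossing_arcs :: "(('r \<times> nat) \<times> ('r \<times> nat)) set" where
  "crossing_arcs = {(u, w). \<exists>a\<in>I. \<exists>p. if \<sigma> p then u = vert a p \<and> w = vert a (Suc p)
     else u = vert a (Suc p) \<and> w = vert a p}"

lemma pattern_copy_vert: "a \<in> I \<Longrightarrow> pattern_copy \<sigma> crossing_arcs (vert a)"
  unfolding pattern_copy_def crossing_arcs_def by (auto simp: inj_def vert_same_ray)

lemma crossing_arcs_irrefl: "(u, u) \<notin> crossing_arcs"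
  unfolding crossing_arcs_def by (auto simp: vert_same_ray split: if_splits)

section \<open>Finite initial parts and the tails of copies\<close>

text \<open>The finite part that a copy has to leave. It is closed under going back along a ray, so
  that it can only be left in the forward direction.\<close>

definition low :: "nat \<Rightarrow> ('r \<times> nat) set" where
  "low e = (\<Union>f\<le>Suc (2 * e). vert (r f) ` {..z f})"

text \<open>Identification does not enlarge the set: the bound \<open>Suc (2 * e)\<close> is odd, so
  a crossing has both of its points below it or neither.\<close>

lemma vert_in_low: "vert b q \<in> low e \<longleftrightarrow> (\<exists>f\<le>Suc (2 * e). b = r f \<and> q \<le> z f)"
proof
  assume "vert b q \<in> low e"
  then obtain f q' where f: "f \<le> Suc (2 * e)" "q' \<le> z f" and eq: "vert (r f) q' = vert b q"
    unfolding low_def by force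
  from vert_eq[OF eq] show "\<exists>f\<le>Suc (2 * e). b = r f \<and> q \<le> z f"
  proof (elim disjE exE conjE)
    fix g assume g: "q' = z g" "b = r (partner g)" "q = z (partner g)"
    then have "g \<le> f" using f mono by (simp add: strict_mono_less_eq)
    then have "partner g \<le> Suc (2 * e)" using f by (simp add: partner_le)
    with g show ?thesis by blast
  qed (use f in blast)
qed (auto simp: low_def)

lemma finite_low: "finite (low e)"
  by (simp add: low_def)

text \<open>The bound is the threshold in \<open>growth\<close> for
  \<open>f = Suc (2 * e)\<close>.\<close>

lemma card_low: "card (low e) \<le> Suc (Suc (2 * e)) * Suc (z (Suc (2 * e)))"
proof -
  have "card (low e) \<le> (\<Sum>f\<le>Suc (2 * e). card (vert (r f) ` {..z f}))"
    unfolding low_def by (rule card_UN_le) simp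
  also have "\<dots> \<le> (\<Sum>f\<le>Suc (2 * e). Suc (z (Suc (2 * e))))"
  proof (rule sum_mono)
    fix f assume "f \<in> {..Suc (2 * e)}"
    then have "z f \<le> z (Suc (2 * e))" using mono by (simp add: strict_mono_less_eq)
    then show "card (vert (r f) ` {..z f}) \<le> Suc (z (Suc (2 * e)))"
      using card_image_le[of "{..z f}" "vert (r f)"] by simp
  qed
  finally show ?thesis by simp
qed

text \<open>A step of a copy uses an arc of some ray, forwards or backwards; going backwards
  reverses the orientation seen, hence \<open>\<sigma> q \<noteq> \<sigma> n\<close> in the second
  case.\<close>

lemma copy_step:
  assumes "pattern_copy \<sigma> crossing_arcs c"
  obtains b q where "b \<in> I" "c n = vert b q" "c (Suc n) = vert b (Suc q)" "\<sigma> q = \<sigma> n"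
  | b q where "b \<in> I" "c n = vert b (Suc q)" "c (Suc n) = vert b q" "\<sigma> q \<noteq> \<sigma> n"
proof -
  have "if \<sigma> n then (c n, c (Suc n)) \<in> crossing_arcs else (c (Suc n), c n) \<in> crossing_arcs"
    using assms unfolding pattern_copy_def by blast
  then show thesis
    by (cases "\<sigma> n") (auto simp: crossing_arcs_def split: if_splits intro: that)
qed

text \<open>At its first exit from some \<open>low e\<close> the copy has time and position within
  the threshold of \<open>growth\<close>. From then on injectivity forbids turning back, and at each
  crossing the agreement of the patterns forbids changing the ray.\<close>

lemma copy_has_tail_in_ray:
  assumes c: "pattern_copy \<sigma> crossing_arcs c"
  obtains a n p where "a \<in> I" "\<And>i. c (n + i) = vert a (p + i)"
proof -
  obtain a0 q0 where a0: "a0 \<in> I" "c 0 = vert a0 q0"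
    by (rule copy_step[OF c, of 0]) blast+
  \<comment> \<open>The ray of the start vertex has a crossing beyond it, so the copy starts inside
    some \<open>low e\<close>.\<close>
  have "infinite {f. r f = a0}" using often a0 by blast
  then obtain e where e: "q0 \<le> e" "r e = a0"
    unfolding infinite_nat_iff_unbounded_le by blast
  have "e \<le> z e" using mono by (rule strict_mono_imp_increasing)
  then have start: "c 0 \<in> low e"
    unfolding a0(2) vert_in_low using e by (intro exI[of _ e]) auto
  have injc: "inj c" using c by (simp add: pattern_copy_def)
  have "\<exists>m. c m \<notin> low e"
  proof (rule ccontr)
    assume "\<nexists>m. c m \<notin> low e"
    then have "finite (range c)" by (intro finite_subset[OF _ finite_low[of e]]) auto
    with injc show False using finite_imageD by blast
  qed
  then obtain m where m: "c m \<notin> low e" "\<And>k. k < m \<Longrightarrow> c k \<in> low e"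
    using exists_least_iff[of "\<lambda>m. c m \<notin> low e"] by blast
  then obtain n where n: "m = Suc n" using start by (cases m) auto
  let ?B = "Suc (Suc (2 * e)) * Suc (z (Suc (2 * e)))"
  \<comment> \<open>The vertices up to time \<open>n\<close> are distinct elements of
    \<open>low e\<close>, which bounds the exit time.\<close>
  have "card (c ` {..n}) \<le> card (low e)"
    using m n by (intro card_mono finite_low) auto
  then have nB: "n \<le> ?B"
    using card_low[of e] card_image[OF inj_on_subset[OF injc subset_UNIV], of "{..n}"] by simp
  have exit: "\<exists>b q. b \<in> I \<and> c n = vert b q \<and> c (Suc n) = vert b (Suc q) \<and> \<sigma> q = \<sigma> n"
  proof (rule copy_step[OF c, of n])
    fix b q assume h: "c n = vert b (Suc q)" "c (Suc n) = vert b q"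
    have "vert b (Suc q) \<in> low e" using m n h by (metis lessI)
    then have "vert b q \<in> low e" unfolding vert_in_low using Suc_leD by blast
    with h m n show ?thesis by simp
  qed blast
  then obtain b p where b: "b \<in> I" and cn: "c n = vert b p" "c (Suc n) = vert b (Suc p)"
    and type: "\<sigma> p = \<sigma> n" by blast
  \<comment> \<open>A crossing point of \<open>b\<close> beyond \<open>p\<close> with index at most
    \<open>Suc (2 * e)\<close> would put \<open>vert b (Suc p)\<close> into \<open>low e\<close>; so
    every crossing still ahead has a larger index.\<close>
  have "vert b p \<in> low e" "vert b (Suc p) \<notin> low e" using m n cn by (metis lessI)+
  then obtain f where "f \<le> Suc (2 * e)" "p \<le> z f"
    and above: "\<And>g. r g = b \<Longrightarrow> p < z g \<Longrightarrow> Suc (2 * e) < g"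
    unfolding vert_in_low by (metis Suc_leI not_le)
  then have "p \<le> z (Suc (2 * e))" using mono by (meson le_trans strict_mono_less_eq)
  then have pB: "p \<le> ?B" by simp
  have follow: "c (n + i) = vert b (p + i) \<and> c (Suc (n + i)) = vert b (Suc (p + i)) \<and>
      \<sigma> (p + i) = \<sigma> (n + i)" for i
  proof (induction i rule: less_induct)
    case (less i)
    show ?case
    proof (cases i)
      case 0
      then show ?thesis using cn type by simp
    next
      case (Suc j)
      have j: "c (n + j) = vert b (p + j)" "c (n + i) = vert b (p + i)"
        using less.IH[of j] Suc by simp_all
      \<comment> \<open>Changing to the partner ray needs a forward arc with value
        \<open>\<sigma> (n + i)\<close> or a backward arc with the opposite value. A mismatch of
        \<open>\<sigma> (p + i)\<close> and \<open>\<sigma> (n + i)\<close> would by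
        \<open>growth\<close> have an earlier instance, against the induction hypothesis. So they
        agree, and since one crossing point is a source and the other a sink, \<open>turn\<close>
        excludes both arcs.\<close>
      have no_cross: False
        if g: "b = r g" "p + i = z g" and x: "x = z (partner g)"
          and t: "\<sigma> x = \<sigma> (n + i) \<or> \<sigma> (x - 1) \<noteq> \<sigma> (n + i)" for g x
      proof -
        have "Suc (2 * e) < g" using above[of g] g Suc by simp
        then have zle: "z (Suc (Suc (2 * e))) \<le> p + i"
          using g mono by (simp add: strict_mono_less_eq)
        have "\<sigma> (p + i) = \<sigma> (n + i)"
        proof (rule ccontr)
          assume "\<sigma> (p + i) \<noteq> \<sigma> (n + i)"
          from growth[OF nB pB this] obtain k
            where "p + k < z (Suc (Suc (2 * e)))" "\<sigma> (p + k) \<noteq> \<sigma> (n + k)" by blast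
          then show False using less.IH[of k] zle by simp
        qed
        then show False using t x g turn[of g] turn[of "partner g"] by auto
      qed
      show ?thesis
      proof (rule copy_step[OF c, of "n + i"])
        fix d q assume h: "c (n + i) = vert d q" "c (Suc (n + i)) = vert d (Suc q)" "\<sigma> q = \<sigma> (n + i)"
        have "vert b (p + i) = vert d q" using h j by simp
        from vert_eq[OF this] show ?thesis
        proof (elim disjE exE conjE)
          assume "b = d" "p + i = q"
          with h show ?thesis by auto
        next
          fix g assume "b = r g" "p + i = z g" "q = z (partner g)"
          with no_cross h show ?thesis by blast
        qed
      next
        fix d q assume h: "c (n + i) = vert d (Suc q)" "c (Suc (n + i)) = vert d q" "\<sigma> q \<noteq> \<sigma> (n + i)"
        have "vert b (p + i) = vert d (Suc q)" using h j by simp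
        from vert_eq[OF this] show ?thesis
        proof (elim disjE exE conjE)
          \<comment> \<open>Turning back on the same ray would revisit
            \<open>c (n + j)\<close>.\<close>
          assume "b = d" "p + i = Suc q"
          then have "q = p + j" using Suc by simp
          then have "c (Suc (n + i)) = c (n + j)" using h(2) j(1) \<open>b = d\<close> by (simp only:)
          then have "Suc (n + i) = n + j" by (rule injD[OF injc])
          then show ?thesis using Suc by simp
        next
          fix g assume g: "b = r g" "p + i = z g" "Suc q = z (partner g)"
          have "\<sigma> (Suc q - 1) \<noteq> \<sigma> (n + i)" using h(3) by simp
          from no_cross[OF g disjI2[OF this]] show ?thesis ..
        qed
      qed
    qed
  qed
  show ?thesis by (rule that[OF b]) (use follow in blast)
qed

end

section \<open>Choice of the crossing positions and of the rays that cross\<close>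

text \<open>The first value \<open>b\<close> after some value \<open>\<not> b\<close> beyond
  \<open>N\<close> is preceded by \<open>\<not> b\<close>.\<close>

lemma turn_exists:
  fixes \<sigma> :: "nat \<Rightarrow> bool"
  assumes "infinite {n. \<sigma> n}" "infinite {n. \<not> \<sigma> n}"
  shows "\<exists>y>N. \<sigma> y = b \<and> \<sigma> (y - 1) = (\<not> b)"
proof -
  have all: "\<exists>n>M. \<sigma> n = d" for M d
  proof (cases d)
    case True
    then show ?thesis using assms(1) unfolding infinite_nat_iff_unbounded by auto
  next
    case False
    then show ?thesis using assms(2) unfolding infinite_nat_iff_unbounded by auto
  qed
  obtain x where x: "x > N" "\<sigma> x = (\<not> b)" using all by blast
  obtain y' where "y' > x" "\<sigma> y' = b" using all by blast
  then have "\<exists>y. y > x \<and> \<sigma> y = b" by blast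
  then obtain y where y: "y > x" "\<sigma> y = b" "\<And>k. k < y \<Longrightarrow> \<not> (k > x \<and> \<sigma> k = b)"
    using exists_least_iff[of "\<lambda>y. y > x \<and> \<sigma> y = b"] by blast
  have "\<sigma> (y - 1) = (\<not> b)"
  proof (cases "y - 1 = x")
    case True
    then show ?thesis using x by simp
  next
    case False
    then show ?thesis using y(1) y(3)[of "y - 1"] by auto
  qed
  moreover have "y > N" using x y by simp
  ultimately show ?thesis using y by blast
qed

text \<open>Only finitely many pairs are involved, so one bound covers a chosen mismatch for each of
  them.\<close>

lemma mismatch_bound:
  fixes \<sigma> :: "nat \<Rightarrow> bool"
  shows "\<exists>N. \<forall>n\<le>B. \<forall>p\<le>B. (\<exists>i. \<sigma> (p + i) \<noteq> \<sigma> (n + i)) \<longrightarrow>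
    (\<exists>j. p + j < N \<and> \<sigma> (p + j) \<noteq> \<sigma> (n + j))"
proof -
  \<comment> \<open>For a pair without mismatch the value is arbitrary and can only enlarge
    \<open>N\<close>.\<close>
  define w where "w n p = (SOME i. \<sigma> (p + i) \<noteq> \<sigma> (n + i))" for n p
  define N where "N = Suc (B + Max ((\<lambda>(n, p). w n p) ` ({..B} \<times> {..B})))"
  have "p + w n p < N" if "n \<le> B" "p \<le> B" for n p
  proof -
    have "w n p \<le> Max ((\<lambda>(n, p). w n p) ` ({..B} \<times> {..B}))"
      using that by (intro Max_ge) force+
    with that show ?thesis by (simp add: N_def)
  qed
  moreover have "\<sigma> (p + w n p) \<noteq> \<sigma> (n + w n p)" if "\<exists>i. \<sigma> (p + i) \<noteq> \<sigma> (n + i)" for n p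
    unfolding w_def by (rule someI_ex[OF that])
  ultimately show ?thesis by blast
qed

text \<open>Dependent choice: the next position is a turn of the required parity beyond the mismatch
  bound determined by the current one.\<close>

lemma crossing_positions:
  fixes \<sigma> :: "nat \<Rightarrow> bool"
  assumes "infinite {n. \<sigma> n}" "infinite {n. \<not> \<sigma> n}"
  obtains z where "strict_mono z" "\<And>f. 0 < z f" "\<And>f. \<sigma> (z f) \<longleftrightarrow> even f" "\<And>f. \<sigma> (z f - 1) \<longleftrightarrow> odd f"
    "\<And>n p f i. \<lbrakk>n \<le> Suc f * Suc (z f); p \<le> Suc f * Suc (z f); \<sigma> (p + i) \<noteq> \<sigma> (n + i)\<rbrakk>
      \<Longrightarrow> \<exists>j. p + j < z (Suc f) \<and> \<sigma> (p + j) \<noteq> \<sigma> (n + j)"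
proof -
  define P where "P f x \<longleftrightarrow> 0 < x \<and> \<sigma> x = even f \<and> \<sigma> (x - 1) = odd f" for f x :: nat
  define Q where "Q f x y \<longleftrightarrow> x < y \<and> (\<forall>n\<le>Suc f * Suc x. \<forall>p\<le>Suc f * Suc x.
      (\<exists>i. \<sigma> (p + i) \<noteq> \<sigma> (n + i)) \<longrightarrow> (\<exists>j. p + j < y \<and> \<sigma> (p + j) \<noteq> \<sigma> (n + j)))" for f x y :: nat
  have "\<exists>z. \<forall>f. P f (z f) \<and> Q f (z f) (z (Suc f))"
  proof (rule dependent_nat_choice)
    show "\<exists>x. P 0 x" using turn_exists[OF assms, of 0 True] by (simp add: P_def)
    fix x f
    obtain N where N: "\<forall>n\<le>Suc f * Suc x. \<forall>p\<le>Suc f * Suc x. (\<exists>i. \<sigma> (p + i) \<noteq> \<sigma> (n + i)) \<longrightarrow>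
        (\<exists>j. p + j < N \<and> \<sigma> (p + j) \<noteq> \<sigma> (n + j))"
      using mismatch_bound[of "Suc f * Suc x" \<sigma>] by blast
    obtain y where y: "y > max x N" "\<sigma> y = even (Suc f)" "\<sigma> (y - 1) = (\<not> even (Suc f))"
      using turn_exists[OF assms, of "max x N" "even (Suc f)"] by blast
    have "Q f x y"
      unfolding Q_def
    proof (intro conjI allI impI)
      show "x < y" using y by simp
      fix n p assume "n \<le> Suc f * Suc x" "p \<le> Suc f * Suc x" "\<exists>i. \<sigma> (p + i) \<noteq> \<sigma> (n + i)"
      with N obtain j where "p + j < N" "\<sigma> (p + j) \<noteq> \<sigma> (n + j)" by blast
      with y(1) show "\<exists>j. p + j < y \<and> \<sigma> (p + j) \<noteq> \<sigma> (n + j)" by (intro exI[of _ j]) simp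
    qed
    moreover have "P (Suc f) y" using y by (simp add: P_def)
    ultimately show "\<exists>y. P (Suc f) y \<and> Q f x y" by blast
  qed
  then obtain z where z: "\<And>f. P f (z f)" "\<And>f. Q f (z f) (z (Suc f))" by blast
  show ?thesis
  proof (rule that[of z])
    show "strict_mono z" using z(2) by (simp add: strict_mono_Suc_iff Q_def)
    show "0 < z f" "\<sigma> (z f) \<longleftrightarrow> even f" "\<sigma> (z f - 1) \<longleftrightarrow> odd f" for f
      using z(1)[of f] by (simp_all add: P_def)
    show "\<exists>j. p + j < z (Suc f) \<and> \<sigma> (p + j) \<noteq> \<sigma> (n + j)"
      if "n \<le> Suc f * Suc (z f)" "p \<le> Suc f * Suc (z f)" "\<sigma> (p + i) \<noteq> \<sigma> (n + i)" for n p f i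
      using z(2)[of f] that unfolding Q_def by blast
  qed
qed

text \<open>\<open>(k, i)\<close> names the \<open>i\<close>-th ray of the batch of \<open>k\<close>
  rays.\<close>

definition ray_names :: "(nat \<times> nat) set" where
  "ray_names = {(k, i). i < k}"

text \<open>Enumerating the pairs of names from different batches together with a counter repeats
  each pair infinitely often.\<close>

lemma crossing_schedule:
  obtains r :: "nat \<Rightarrow> nat \<times> nat" where "\<And>e. fst (r (2 * e)) \<noteq> fst (r (Suc (2 * e)))"
    "\<And>a b. \<lbrakk>a \<in> ray_names; b \<in> ray_names; fst a \<noteq> fst b\<rbrakk>
      \<Longrightarrow> infinite {e. r (2 * e) = a \<and> r (Suc (2 * e)) = b}"
proof -
  define S where "S = {(a, b). a \<in> ray_names \<and> b \<in> ray_names \<and> fst a \<noteq> fst b}"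
  define g where "g = from_nat_into (S \<times> (UNIV :: nat set))"
  have "((1, 0), (2, 0)) \<in> S" by (simp add: S_def ray_names_def)
  then have "S \<times> (UNIV :: nat set) \<noteq> {}" by blast
  then have g: "range g = S \<times> UNIV"
    unfolding g_def by (intro range_from_nat_into) auto
  define r where "r f = (if even f then fst (fst (g (f div 2))) else snd (fst (g (f div 2))))" for f
  have r: "(r (2 * e), r (Suc (2 * e))) = fst (g e)" for e by (simp add: r_def)
  have rS: "(r (2 * e), r (Suc (2 * e))) \<in> S" for e
    unfolding r using g by (metis mem_Times_iff rangeI)
  show ?thesis
  proof (rule that[of r])
    fix e show "fst (r (2 * e)) \<noteq> fst (r (Suc (2 * e)))" using rS[of e] by (simp add: S_def)
  next
    fix a b assume ab: "a \<in> ray_names" "b \<in> ray_names" "fst a \<noteq> fst b"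
    let ?E = "{e. r (2 * e) = a \<and> r (Suc (2 * e)) = b}"
    have "{(a, b)} \<times> (UNIV :: nat set) \<subseteq> g ` ?E"
    proof
      fix x assume x: "x \<in> {(a, b)} \<times> (UNIV :: nat set)"
      then have "x \<in> range g" using ab unfolding g by (auto simp: S_def)
      then obtain e where "x = g e" by blast
      with x r[of e] have "e \<in> ?E" by auto
      with \<open>x = g e\<close> show "x \<in> g ` ?E" by blast
    qed
    moreover have "infinite ({(a, b)} \<times> (UNIV :: nat set))" by (simp add: finite_cartesian_product_iff)
    ultimately show "infinite ?E" using finite_subset finite_imageI by blast
  qed
qed

section \<open>A digraph with arbitrarily many but not infinitely many disjoint copies\<close>

text \<open>Rays of one batch never cross, so batch \<open>k\<close> supplies \<open>k\<close>
  disjoint copies. In an infinite disjoint family the copies would end in distinct rays, and these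
  would all belong to one batch because rays of different batches cross arbitrarily late; but each
  batch is finite.\<close>

lemma mixed_pattern_counterexample:
  fixes \<sigma> :: "nat \<Rightarrow> bool"
  assumes "infinite {n. \<sigma> n}" "infinite {n. \<not> \<sigma> n}"
  obtains E :: "(((nat \<times> nat) \<times> nat) \<times> ((nat \<times> nat) \<times> nat)) set" where "\<And>u. (u, u) \<notin> E"
    "\<And>k::nat. \<exists>c :: nat \<Rightarrow> nat \<Rightarrow> _. (\<forall>i<k. pattern_copy \<sigma> E (c i)) \<and> disjoint_ranges {..<k} c"
    "\<nexists>c :: nat \<Rightarrow> nat \<Rightarrow> _. (\<forall>i. pattern_copy \<sigma> E (c i)) \<and> disjoint_ranges UNIV c"
proof -
  obtain z where z: "strict_mono z" "\<And>f. 0 < z f" "\<And>f. \<sigma> (z f) \<longleftrightarrow> even f" "\<And>f. \<sigma> (z f - 1) \<longleftrightarrow> odd f"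
    "\<And>n p f i. \<lbrakk>n \<le> Suc f * Suc (z f); p \<le> Suc f * Suc (z f); \<sigma> (p + i) \<noteq> \<sigma> (n + i)\<rbrakk>
      \<Longrightarrow> \<exists>j. p + j < z (Suc f) \<and> \<sigma> (p + j) \<noteq> \<sigma> (n + j)"
    by (rule crossing_positions[OF assms]) (rule that; assumption)
  obtain r :: "nat \<Rightarrow> nat \<times> nat" where fam: "\<And>e. fst (r (2 * e)) \<noteq> fst (r (Suc (2 * e)))"
    and meet: "\<And>a b. \<lbrakk>a \<in> ray_names; b \<in> ray_names; fst a \<noteq> fst b\<rbrakk>
      \<Longrightarrow> infinite {e. r (2 * e) = a \<and> r (Suc (2 * e)) = b}"
    by (rule crossing_schedule) (rule that; assumption)
  have often: "infinite {f. r f = a}" if a: "a \<in> ray_names" for a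
  proof -
    \<comment> \<open>A ray of another batch; that batch is nonempty, having a positive number of
      rays.\<close>
    have "(Suc (fst a), 0) \<in> ray_names" by (simp add: ray_names_def)
    then have "infinite {e. r (2 * e) = a \<and> r (Suc (2 * e)) = (Suc (fst a), 0)}"
      using meet[OF a] by simp
    then have "infinite ((*) 2 ` {e. r (2 * e) = a \<and> r (Suc (2 * e)) = (Suc (fst a), 0)})"
      by (subst finite_image_iff) (auto simp: inj_on_def)
    moreover have "(*) 2 ` {e. r (2 * e) = a \<and> r (Suc (2 * e)) = (Suc (fst a), 0)} \<subseteq> {f. r f = a}"
      by auto
    ultimately show ?thesis using finite_subset by blast
  qed
  interpret crossing_rays \<sigma> ray_names r z
  proof
    show "r (2 * e) \<noteq> r (Suc (2 * e))" for e using fam[of e] by auto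
  qed (fact z often)+
  show ?thesis
  proof (rule that[of crossing_arcs])
    show "(u, u) \<notin> crossing_arcs" for u by (rule crossing_arcs_irrefl)
    show "\<exists>c :: nat \<Rightarrow> nat \<Rightarrow> _. (\<forall>i<k. pattern_copy \<sigma> crossing_arcs (c i)) \<and> disjoint_ranges {..<k} c" for k
    proof (intro exI[of _ "\<lambda>i. vert (k, i)"] conjI allI impI)
      show "pattern_copy \<sigma> crossing_arcs (vert (k, i))" if "i < k" for i
        using that by (intro pattern_copy_vert) (simp add: ray_names_def)
      have "i = j" if eq: "vert (k, i) m = vert (k, j) n" for i j m n
      proof -
        have "fst (r (partner f)) \<noteq> fst (r f)" for f
        proof (cases "even f")
          case True
          then obtain e where "f = 2 * e" by (elim evenE)
          then show ?thesis using fam[of e] by (simp add: partner_def)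
        next
          case False
          then obtain e where "f = Suc (2 * e)" by (elim oddE) simp
          then show ?thesis using fam[of e] by (simp add: partner_def)
        qed
        with vert_eq[OF eq] show ?thesis by (metis fst_conv snd_conv)
      qed
      then show "disjoint_ranges {..<k} (\<lambda>i. vert (k, i))"
        unfolding disjoint_ranges_def by blast
    qed
    show "\<nexists>c :: nat \<Rightarrow> nat \<Rightarrow> _. (\<forall>i. pattern_copy \<sigma> crossing_arcs (c i)) \<and> disjoint_ranges UNIV c"
    proof
      assume "\<exists>c :: nat \<Rightarrow> nat \<Rightarrow> _. (\<forall>i. pattern_copy \<sigma> crossing_arcs (c i)) \<and> disjoint_ranges UNIV c"
      then obtain c :: "nat \<Rightarrow> nat \<Rightarrow> _" where c: "\<And>i. pattern_copy \<sigma> crossing_arcs (c i)"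
        and disj: "disjoint_ranges UNIV c" by blast
      have "\<exists>a n p. a \<in> ray_names \<and> (\<forall>i. c j (n + i) = vert a (p + i))" for j
        using copy_has_tail_in_ray[OF c[of j]] by metis
      then obtain a n p where a: "\<And>j. a j \<in> ray_names"
        and tail: "\<And>j i. c j (n j + i) = vert (a j) (p j + i)" by metis
      \<comment> \<open>Beyond \<open>p j\<close> and \<open>p j'\<close> the rays consist of
        vertices of copies \<open>j\<close> and \<open>j'\<close>, so a common vertex there
        identifies the copies.\<close>
      have meet_eq: "j = j'"
        if "vert (a j) x = vert (a j') x'" "p j \<le> x" "p j' \<le> x'" for j j' x x'
      proof -
        have "c j (n j + (x - p j)) = c j' (n j' + (x' - p j'))"
          using that tail[of j "x - p j"] tail[of j' "x' - p j'"] by simp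
        then show ?thesis using disjoint_rangesD[OF disj] by blast
      qed
      have inj: "inj a"
      proof (rule injI)
        fix j j' assume "a j = a j'"
        then show "j = j'" using meet_eq[of j "p j + p j'" j' "p j + p j'"] by simp
      qed
      have "fst (a j) = fst (a 0)" for j
      proof (rule ccontr)
        assume ne: "fst (a j) \<noteq> fst (a 0)"
        \<comment> \<open>Since \<open>f \<le> z f\<close>, a crossing with such a late index lies
          in both tails.\<close>
        from meet[OF a a this] obtain e where e: "p j + p 0 \<le> e"
          and re: "r (2 * e) = a j" "r (Suc (2 * e)) = a 0"
          unfolding infinite_nat_iff_unbounded_le by blast
        have "2 * e \<le> z (2 * e)" "Suc (2 * e) \<le> z (Suc (2 * e))"
          using strict_mono_imp_increasing[OF mono] by blast+
        with e have "0 = j" using meet_eq[of 0 "z (Suc (2 * e))" j "z (2 * e)"] vert_crossing[of e] re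
          by simp
        with ne show False by simp
      qed
      then have "a j \<in> {fst (a 0)} \<times> {..<fst (a 0)}" for j
        using a[of j] by (cases "a j") (auto simp: ray_names_def; metis fst_conv)
      then have "range a \<subseteq> {fst (a 0)} \<times> {..<fst (a 0)}" by blast
      then have "finite (range a)" using finite_subset by blast
      with inj show False using finite_imageD by blast
    qed
  qed
qed

section \<open>Copies of an oriented ray\<close>

definition ray_pattern :: "'a pair_pre_digraph \<Rightarrow> (nat \<Rightarrow> 'a) \<Rightarrow> nat \<Rightarrow> bool" where
  "ray_pattern R x n \<longleftrightarrow> (x n, x (Suc n)) \<in> parcs R"

definition pattern_arc :: "(nat \<Rightarrow> bool) \<Rightarrow> (nat \<Rightarrow> 'v) \<Rightarrow> nat \<Rightarrow> 'v \<times> 'v" where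
  "pattern_arc \<sigma> c n = (if \<sigma> n then (c n, c (Suc n)) else (c (Suc n), c n))"

lemma pattern_copy_iff: "pattern_copy \<sigma> E c \<longleftrightarrow> inj c \<and> range (pattern_arc \<sigma> c) \<subseteq> E"
  unfolding pattern_copy_def pattern_arc_def by (auto split: if_splits)

text \<open>Every edge of the ray comes from an arc in one of its two directions, and asymmetry
  excludes the other direction.\<close>

lemma parcs_oriented_ray:
  assumes R: "oriented_ray R" and x: "ray_enum (pverts R) (underlying_edges R) x"
  shows "parcs R = range (pattern_arc (ray_pattern R x) x)"
proof
  have E: "underlying_edges R = range (\<lambda>n. {x n, x (Suc n)})" using x by (simp add: ray_enum_def)
  have asym: "(v, u) \<notin> parcs R" if "(u, v) \<in> parcs R" for u v
    using R that unfolding oriented_ray_def by (auto dest: asymD)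
  show "range (pattern_arc (ray_pattern R x) x) \<subseteq> parcs R"
  proof
    fix a assume "a \<in> range (pattern_arc (ray_pattern R x) x)"
    then obtain n where n: "a = pattern_arc (ray_pattern R x) x n" by blast
    have "{x n, x (Suc n)} \<in> underlying_edges R" unfolding E by blast
    then obtain u v where "(u, v) \<in> parcs R" "{x n, x (Suc n)} = {u, v}"
      unfolding underlying_edges_def by blast
    then have "(x n, x (Suc n)) \<in> parcs R \<or> (x (Suc n), x n) \<in> parcs R"
      by (auto simp: doubleton_eq_iff)
    then show "a \<in> parcs R" unfolding n pattern_arc_def ray_pattern_def by auto
  qed
  show "parcs R \<subseteq> range (pattern_arc (ray_pattern R x) x)"
  proof
    fix a assume a: "a \<in> parcs R"
    obtain u v where uv: "a = (u, v)" by (cases a)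
    then have "{u, v} \<in> range (\<lambda>n. {x n, x (Suc n)})"
      using a unfolding E[symmetric] underlying_edges_def by blast
    then obtain n where "{u, v} = {x n, x (Suc n)}" by blast
    then have "u = x n \<and> v = x (Suc n) \<or> u = x (Suc n) \<and> v = x n"
      by (simp only: doubleton_eq_iff)
    then have "a = pattern_arc (ray_pattern R x) x n"
      using a asym[of u v] unfolding uv pattern_arc_def ray_pattern_def
      by (elim disjE conjE) simp_all
    then show "a \<in> range (pattern_arc (ray_pattern R x) x)" by blast
  qed
qed

lemma copy_imp_pattern_copy:
  assumes R: "oriented_ray R" and x: "ray_enum (pverts R) (underlying_edges R) x"
    and sub: "subgraph (with_proj S) (with_proj D)" and iso: "digraph_iso (with_proj R) (with_proj S)"
  obtains c where "pattern_copy (ray_pattern R x) (parcs D) c" "range c = pverts S"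
proof -
  have V: "pverts R = range x" and injx: "inj x"
    using x by (auto simp: ray_enum_def bij_betw_def)
  obtain h where h: "pre_digraph.digraph_isomorphism (with_proj R) h"
    and S: "with_proj S = app_iso h (with_proj R)" using iso unfolding digraph_iso_def by blast
  \<comment> \<open>As \<open>S\<close> is a pair digraph, the tail and head maps of
    \<open>h\<close> are forced to be the projections, so the image of an arc is determined by the
    images of its ends.\<close>
  have vS: "pverts S = iso_verts h ` pverts R" and aS: "parcs S = iso_arcs h ` parcs R"
    and tl: "iso_tail h = fst" and hd: "iso_head h = snd"
    using arg_cong[OF S, of verts] arg_cong[OF S, of arcs] arg_cong[OF S, of tail] arg_cong[OF S, of head]
    by (simp_all add: app_iso_def)
  have injh: "inj_on (iso_verts h) (pverts R)"
    and ends: "\<And>a. a \<in> parcs R \<Longrightarrow> iso_arcs h a = (iso_verts h (fst a), iso_verts h (snd a))"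
    using h unfolding pre_digraph.digraph_isomorphism_def by (simp_all add: tl hd prod_eq_iff)
  let ?\<sigma> = "ray_pattern R x" and ?c = "iso_verts h \<circ> x"
  show ?thesis
  proof (rule that[of ?c])
    show "range ?c = pverts S" by (simp add: vS V image_comp)
    have "pattern_arc ?\<sigma> ?c n \<in> parcs D" for n
    proof -
      have "pattern_arc ?\<sigma> x n \<in> parcs R" using parcs_oriented_ray[OF R x] by blast
      moreover have "pattern_arc ?\<sigma> ?c n = (iso_verts h (fst (pattern_arc ?\<sigma> x n)), iso_verts h (snd (pattern_arc ?\<sigma> x n)))"
        by (simp add: pattern_arc_def)
      ultimately have "pattern_arc ?\<sigma> ?c n \<in> parcs S" using ends aS by (metis image_eqI)
      then show ?thesis using sub by (auto simp: subgraph_def)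
    qed
    moreover have "inj ?c" using injx injh V by (simp add: comp_inj_on)
    ultimately show "pattern_copy ?\<sigma> (parcs D) ?c" by (auto simp: pattern_copy_iff)
  qed
qed

lemma pattern_copy_imp_copy:
  assumes R: "oriented_ray R" and x: "ray_enum (pverts R) (underlying_edges R) x"
    and D: "pair_loopfree_digraph D" and c: "pattern_copy (ray_pattern R x) (parcs D) c"
  obtains S where "subgraph (with_proj S) (with_proj D)" "digraph_iso (with_proj R) (with_proj S)"
    "pverts S = range c"
proof -
  let ?\<sigma> = "ray_pattern R x"
  have V: "pverts R = range x" and injx: "inj x"
    using x by (auto simp: ray_enum_def bij_betw_def)
  have injc: "inj c" and arcs: "range (pattern_arc ?\<sigma> c) \<subseteq> parcs D" using c by (auto simp: pattern_copy_iff)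
  interpret D: pair_loopfree_digraph D by (rule D)
  interpret R: pair_loopfree_digraph R using R by (simp add: oriented_ray_def)
  define S where "S = \<lparr>pverts = range c, parcs = range (pattern_arc ?\<sigma> c)\<rparr>"
  define \<phi> where "\<phi> = c \<circ> inv x"
  have \<phi>: "\<phi> (x n) = c n" for n using injx by (simp add: \<phi>_def)
  have inj\<phi>: "inj_on \<phi> (range x)"
    by (rule inj_onI) (use injc in \<open>auto simp: \<phi> inj_eq\<close>)
  have arc\<phi>: "map_prod \<phi> \<phi> (pattern_arc ?\<sigma> x n) = pattern_arc ?\<sigma> c n" for n
    by (simp add: pattern_arc_def \<phi>)
  have wfS: "wf_digraph (with_proj S)"
    unfolding wf_digraph_wp_iff by unfold_locales (auto simp: S_def pattern_arc_def)
  have wfD: "wf_digraph (with_proj D)" unfolding wf_digraph_wp_iff by unfold_locales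
  have "c n \<in> pverts D" for n
  proof -
    have "pattern_arc ?\<sigma> c n \<in> parcs D" using arcs by blast
    from D.arc_fst_in_verts[OF this] D.arc_snd_in_verts[OF this] show ?thesis
      by (simp add: pattern_arc_def split: if_splits)
  qed
  then have "subgraph (with_proj S) (with_proj D)"
    unfolding subgraph_def using wfS wfD arcs by (auto simp: S_def compatible_def)
  moreover have "digraph_iso (with_proj R) (with_proj S)"
    unfolding digraph_iso_def
  proof (intro exI conjI)
    let ?h = "\<lparr>iso_verts = \<phi>, iso_arcs = map_prod \<phi> \<phi>, iso_head = snd, iso_tail = fst\<rparr>"
    have "parcs R \<subseteq> range x \<times> range x"
      unfolding V[symmetric] using R.arc_fst_in_verts R.arc_snd_in_verts by fastforce
    then have "inj_on (map_prod \<phi> \<phi>) (parcs R)"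
      using map_prod_inj_on[OF inj\<phi> inj\<phi>] inj_on_subset by blast
    then show "pre_digraph.digraph_isomorphism (with_proj R) ?h"
      unfolding pre_digraph.digraph_isomorphism_def
      using inj\<phi> V R.wf_digraph by (auto simp: wf_digraph_wp_iff)
    have "\<phi> ` pverts R = range c" by (auto simp: V \<phi> image_image)
    moreover have "map_prod \<phi> \<phi> ` parcs R = range (pattern_arc ?\<sigma> c)"
      unfolding parcs_oriented_ray[OF R x] by (simp add: image_image arc\<phi>)
    ultimately show "with_proj S = app_iso ?h (with_proj R)"
      by (simp add: app_iso_def with_proj_def S_def)
  qed
  moreover have "pverts S = range c" by (simp add: S_def)
  ultimately show ?thesis by (rule that)
qed

lemma disjoint_ranges_reindex:
  "disjoint_ranges I c \<Longrightarrow> inj_on g J \<Longrightarrow> g ` J \<subseteq> I \<Longrightarrow> disjoint_ranges J (\<lambda>j. c (g j))"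
  unfolding disjoint_ranges_def inj_on_def by blast

lemma disjoint_copies_imp_pattern_copies:
  assumes R: "oriented_ray R" and x: "ray_enum (pverts R) (underlying_edges R) x"
    and F: "disjoint_copies R D F"
  obtains c where "\<And>S. S \<in> F \<Longrightarrow> pattern_copy (ray_pattern R x) (parcs D) (c S)"
    "disjoint_ranges F c"
proof -
  have "\<forall>S\<in>F. \<exists>c. pattern_copy (ray_pattern R x) (parcs D) c \<and> range c = pverts S"
    using F copy_imp_pattern_copy[OF R x] unfolding disjoint_copies_def by metis
  from bchoice[OF this] obtain c where c: "\<And>S. S \<in> F \<Longrightarrow> pattern_copy (ray_pattern R x) (parcs D) (c S)"
    and ran: "\<And>S. S \<in> F \<Longrightarrow> range (c S) = pverts S" by blast
  have "disjoint_ranges F c"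
    unfolding disjoint_ranges_def
  proof (intro ballI allI impI, rule ccontr)
    fix S T m n assume ST: "S \<in> F" "T \<in> F" "c S m = c T n" "S \<noteq> T"
    then have "c S m \<in> pverts S \<inter> pverts T" using ran by (metis IntI rangeI)
    moreover have "pverts S \<inter> pverts T = {}"
      using F ST unfolding disjoint_copies_def by (auto dest: pairwiseD)
    ultimately show False by simp
  qed
  with c show ?thesis by (rule that)
qed

lemma pattern_copies_imp_disjoint_copies:
  assumes R: "oriented_ray R" and x: "ray_enum (pverts R) (underlying_edges R) x"
    and D: "pair_loopfree_digraph D"
    and c: "\<And>i. i \<in> I \<Longrightarrow> pattern_copy (ray_pattern R x) (parcs D) (c i)"
    and disj: "disjoint_ranges I c"
  obtains S where "disjoint_copies R D (S ` I)" "inj_on S I"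
proof -
  have "\<forall>i\<in>I. \<exists>S. subgraph (with_proj S) (with_proj D) \<and>
      digraph_iso (with_proj R) (with_proj S) \<and> pverts S = range (c i)"
    using pattern_copy_imp_copy[OF R x D c] by metis
  from bchoice[OF this] obtain S where S: "\<And>i. i \<in> I \<Longrightarrow> subgraph (with_proj (S i)) (with_proj D) \<and>
      digraph_iso (with_proj R) (with_proj (S i)) \<and> pverts (S i) = range (c i)" by blast
  have same: "i = j" if "i \<in> I" "j \<in> I" "pverts (S i) \<inter> pverts (S j) \<noteq> {}" for i j
  proof -
    from that S obtain m n where "c i m = c j n" by fastforce
    then show ?thesis using disjoint_rangesD[OF disj] that by blast
  qed
  show ?thesis
  proof (rule that)
    show "inj_on S I"
    proof (rule inj_onI)
      fix i j assume "i \<in> I" "j \<in> I" "S i = S j"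
      \<comment> \<open>A copy has vertices, so equal copies have intersecting vertex sets.\<close>
      then show "i = j" using same[of i j] S by auto
    qed
    have "pairwise (\<lambda>S T. pverts S \<inter> pverts T = {}) (S ` I)"
      unfolding pairwise_def using same by blast
    then show "disjoint_copies R D (S ` I)"
      unfolding disjoint_copies_def using S by blast
  qed
qed

lemma disjoint_copies_card_iff:
  assumes R: "oriented_ray R" and x: "ray_enum (pverts R) (underlying_edges R) x"
    and D: "pair_loopfree_digraph (D :: 'v pair_pre_digraph)"
  shows "(\<exists>F. disjoint_copies R D F \<and> finite F \<and> card F = k) \<longleftrightarrow>
    (\<exists>c :: nat \<Rightarrow> nat \<Rightarrow> 'v. (\<forall>i<k. pattern_copy (ray_pattern R x) (parcs D) (c i)) \<and>
      disjoint_ranges {..<k} c)"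
proof
  assume "\<exists>F. disjoint_copies R D F \<and> finite F \<and> card F = k"
  then obtain F where F: "disjoint_copies R D F" "finite F" "card F = k" by blast
  obtain c where c: "\<And>S. S \<in> F \<Longrightarrow> pattern_copy (ray_pattern R x) (parcs D) (c S)"
    "disjoint_ranges F c" by (rule disjoint_copies_imp_pattern_copies[OF R x F(1)]) blast
  obtain g where "bij_betw g {..<k} F"
    using ex_bij_betw_nat_finite[OF F(2)] F(3) by (auto simp: atLeast0LessThan)
  then have "inj_on g {..<k}" "g ` {..<k} \<subseteq> F" by (auto simp: bij_betw_def)
  then show "\<exists>c :: nat \<Rightarrow> nat \<Rightarrow> 'v. (\<forall>i<k. pattern_copy (ray_pattern R x) (parcs D) (c i)) \<and>
      disjoint_ranges {..<k} c"
    using c(1) disjoint_ranges_reindex[OF c(2)]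
    by (intro exI[of _ "\<lambda>i. c (g i)"]) auto
next
  assume "\<exists>c :: nat \<Rightarrow> nat \<Rightarrow> 'v. (\<forall>i<k. pattern_copy (ray_pattern R x) (parcs D) (c i)) \<and>
      disjoint_ranges {..<k} c"
  then obtain c :: "nat \<Rightarrow> nat \<Rightarrow> 'v"
    where "\<And>i. i \<in> {..<k} \<Longrightarrow> pattern_copy (ray_pattern R x) (parcs D) (c i)"
      "disjoint_ranges {..<k} c" by auto
  then obtain S where "disjoint_copies R D (S ` {..<k})" "inj_on S {..<k}"
    by (rule pattern_copies_imp_disjoint_copies[OF R x D])
  then show "\<exists>F. disjoint_copies R D F \<and> finite F \<and> card F = k"
    by (intro exI[of _ "S ` {..<k}"]) (simp add: card_image)
qed

lemma disjoint_copies_infinite_iff: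
  assumes R: "oriented_ray R" and x: "ray_enum (pverts R) (underlying_edges R) x"
    and D: "pair_loopfree_digraph (D :: 'v pair_pre_digraph)"
  shows "(\<exists>F. disjoint_copies R D F \<and> infinite F) \<longleftrightarrow>
    (\<exists>c :: nat \<Rightarrow> nat \<Rightarrow> 'v. (\<forall>i. pattern_copy (ray_pattern R x) (parcs D) (c i)) \<and>
      disjoint_ranges UNIV c)"
proof
  assume "\<exists>F. disjoint_copies R D F \<and> infinite F"
  then obtain F where F: "disjoint_copies R D F" "infinite F" by blast
  obtain c where c: "\<And>S. S \<in> F \<Longrightarrow> pattern_copy (ray_pattern R x) (parcs D) (c S)"
    "disjoint_ranges F c" by (rule disjoint_copies_imp_pattern_copies[OF R x F(1)]) blast
  obtain g :: "nat \<Rightarrow> _" where "inj g" "range g \<subseteq> F"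
    using infinite_countable_subset[OF F(2)] by blast
  then show "\<exists>c :: nat \<Rightarrow> nat \<Rightarrow> 'v. (\<forall>i. pattern_copy (ray_pattern R x) (parcs D) (c i)) \<and>
      disjoint_ranges UNIV c"
    using c(1) disjoint_ranges_reindex[OF c(2)]
    by (intro exI[of _ "\<lambda>i. c (g i)"]) auto
next
  assume "\<exists>c :: nat \<Rightarrow> nat \<Rightarrow> 'v. (\<forall>i. pattern_copy (ray_pattern R x) (parcs D) (c i)) \<and>
      disjoint_ranges UNIV c"
  then obtain c :: "nat \<Rightarrow> nat \<Rightarrow> 'v"
    where c: "\<And>i. pattern_copy (ray_pattern R x) (parcs D) (c i)" "disjoint_ranges UNIV c" by auto
  obtain S :: "nat \<Rightarrow> _" where "disjoint_copies R D (range S)" "inj S"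
    by (rule pattern_copies_imp_disjoint_copies[OF R x D c])
  then show "\<exists>F. disjoint_copies R D F \<and> infinite F"
    using finite_imageD by blast
qed

section \<open>Orientation of arcs read off the pattern\<close>

lemma finite_not_in_oriented_iff:
  assumes x: "ray_enum (pverts R) (underlying_edges R) x"
  shows "finite {a \<in> parcs R. \<not> in_oriented R a} \<longleftrightarrow> finite {n. ray_pattern R x n}"
proof -
  have "inj x" using x by (simp add: ray_enum_def bij_betw_def)
  have inj: "inj_on (\<lambda>n. (x n, x (Suc n))) A" for A by (rule inj_onI) (simp add: inj_eq[OF \<open>inj x\<close>])
  have "{a \<in> parcs R. \<not> in_oriented R a} = {a. out_oriented R a}" by (auto simp: out_oriented_def)
  also have "\<dots> = (\<lambda>n. (x n, x (Suc n))) ` {n. ray_pattern R x n}"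
    by (auto simp: out_oriented_iff[OF x] ray_pattern_def)
  finally show ?thesis using finite_image_iff[OF inj] by simp
qed

lemma finite_not_out_oriented_iff:
  assumes R: "oriented_ray R" and x: "ray_enum (pverts R) (underlying_edges R) x"
  shows "finite {a \<in> parcs R. \<not> out_oriented R a} \<longleftrightarrow> finite {n. \<not> ray_pattern R x n}"
proof -
  have "inj x" using x by (simp add: ray_enum_def bij_betw_def)
  have inj: "inj_on (\<lambda>n. (x (Suc n), x n)) A" for A by (rule inj_onI) (simp add: inj_eq[OF \<open>inj x\<close>])
  have arc: "(x (Suc n), x n) \<in> parcs R \<longleftrightarrow> \<not> ray_pattern R x n" for n
  proof
    assume "(x (Suc n), x n) \<in> parcs R"
    then show "\<not> ray_pattern R x n"
      using R unfolding oriented_ray_def ray_pattern_def by (auto dest: asymD)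
  next
    assume "\<not> ray_pattern R x n"
    then have "(x (Suc n), x n) = pattern_arc (ray_pattern R x) x n" by (simp add: pattern_arc_def)
    then show "(x (Suc n), x n) \<in> parcs R" using parcs_oriented_ray[OF R x] by auto
  qed
  have "{a \<in> parcs R. \<not> out_oriented R a} = {a. in_oriented R a}"
    by (auto simp: out_oriented_def in_oriented_def)
  also have "\<dots> = (\<lambda>n. (x (Suc n), x n)) ` {n. \<not> ray_pattern R x n}"
    by (auto simp: in_oriented_iff[OF x] arc)
  finally show ?thesis using finite_image_iff[OF inj] by simp
qed

section \<open>Reversal of arcs and change of the vertex type\<close>

text \<open>This reduces eventually in-oriented rays to eventually out-oriented ones.\<close>

lemma pattern_copy_converse: "pattern_copy (\<lambda>n. \<not> \<sigma> n) (E\<inverse>) c \<longleftrightarrow> pattern_copy \<sigma> E c"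
  unfolding pattern_copy_def by auto

text \<open>Moves the counterexample to another vertex type. Every vertex of a copy is an end of an
  arc and so lies in the range of \<open>h\<close>; vertices outside that range create no further
  copies.\<close>

lemma pattern_copy_image:
  assumes h: "inj h"
  shows "pattern_copy \<sigma> (map_prod h h ` E) c \<longleftrightarrow> (\<exists>d. c = h \<circ> d \<and> pattern_copy \<sigma> E d)"
proof
  have mem: "(h u, h v) \<in> map_prod h h ` E \<longleftrightarrow> (u, v) \<in> E" for u v
    using inj_image_mem_iff[OF prod.inj_map[OF h h], of "(u, v)" E] by simp
  show "\<exists>d. c = h \<circ> d \<and> pattern_copy \<sigma> E d" if c: "pattern_copy \<sigma> (map_prod h h ` E) c"
  proof -
    have "c n \<in> range h" for n
    proof -
      have "if \<sigma> n then (c n, c (Suc n)) \<in> map_prod h h ` E else (c (Suc n), c n) \<in> map_prod h h ` E"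
        using c unfolding pattern_copy_def by blast
      then show ?thesis by (auto split: if_splits)
    qed
    then have "\<forall>n. \<exists>v. c n = h v" by blast
    then obtain d where d: "\<And>n. c n = h (d n)" by metis
    then have "c = h \<circ> d" by auto
    moreover have "pattern_copy \<sigma> E d"
      using c h unfolding pattern_copy_def d mem by (simp add: inj_def)
    ultimately show ?thesis by blast
  qed
  show "pattern_copy \<sigma> (map_prod h h ` E) c" if "\<exists>d. c = h \<circ> d \<and> pattern_copy \<sigma> E d"
  proof -
    from that obtain d where "c = h \<circ> d" "pattern_copy \<sigma> E d" by blast
    then show ?thesis
      unfolding pattern_copy_def using h by (simp add: mem inj_compose)
  qed
qed

lemma disjoint_ranges_comp_inj: "inj h \<Longrightarrow> disjoint_ranges I (\<lambda>i. h \<circ> d i) \<longleftrightarrow> disjoint_ranges I d"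
  unfolding disjoint_ranges_def by (simp add: inj_eq)

theorem theorem1p1:
  fixes R :: "'a pair_pre_digraph"
  assumes "oriented_ray R"
  shows "ubiquitous TYPE('v::infinite) R \<longleftrightarrow>
    finite {a \<in> parcs R. \<not> in_oriented R a} \<or> finite {a \<in> parcs R. \<not> out_oriented R a}"
proof -
  note R = assms
  obtain x where x: "ray_enum (pverts R) (underlying_edges R) x"
    using R unfolding oriented_ray_def is_ray_def by blast
  let ?\<sigma> = "ray_pattern R x"
  show ?thesis
    unfolding finite_not_in_oriented_iff[OF x] finite_not_out_oriented_iff[OF R x]
  proof
    assume ubi: "ubiquitous TYPE('v) R"
    show "finite {n. ?\<sigma> n} \<or> finite {n. \<not> ?\<sigma> n}"
    proof (rule ccontr)
      assume "\<not> ?thesis"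
      then have inf: "infinite {n. ?\<sigma> n}" "infinite {n. \<not> ?\<sigma> n}" by simp_all
      obtain E :: "(((nat \<times> nat) \<times> nat) \<times> ((nat \<times> nat) \<times> nat)) set" where irrefl: "\<And>u. (u, u) \<notin> E"
        and many: "\<And>k::nat. \<exists>c :: nat \<Rightarrow> nat \<Rightarrow> _. (\<forall>i<k. pattern_copy ?\<sigma> E (c i)) \<and> disjoint_ranges {..<k} c"
        and few: "\<nexists>c :: nat \<Rightarrow> nat \<Rightarrow> _. (\<forall>i. pattern_copy ?\<sigma> E (c i)) \<and> disjoint_ranges UNIV c"
        by (rule mixed_pattern_counterexample[OF inf]) blast
      \<comment> \<open>The counterexample has countably many vertices, so it embeds into the
        infinite type \<open>'v\<close>.\<close>
      obtain g :: "nat \<Rightarrow> 'v" where "inj g"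
        using infinite_countable_subset[OF infinite_UNIV] by blast
      define h :: "(nat \<times> nat) \<times> nat \<Rightarrow> 'v" where "h = g \<circ> to_nat"
      have h: "inj h" unfolding h_def using \<open>inj g\<close> by (intro inj_compose) auto
      define D where "D = \<lparr>pverts = UNIV, parcs = map_prod h h ` E\<rparr>"
      have D: "pair_loopfree_digraph D"
        by unfold_locales (use irrefl h in \<open>auto simp: D_def inj_eq\<close>)
      have "\<exists>F. disjoint_copies R D F \<and> finite F \<and> card F = k" for k
      proof -
        obtain c :: "nat \<Rightarrow> nat \<Rightarrow> _" where c: "\<forall>i<k. pattern_copy ?\<sigma> E (c i)" "disjoint_ranges {..<k} c"
          using many by blast
        then have "\<forall>i<k. pattern_copy ?\<sigma> (parcs D) (h \<circ> c i)"
          unfolding D_def by (auto simp: pattern_copy_image[OF h])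
        moreover have "disjoint_ranges {..<k} (\<lambda>i. h \<circ> c i)"
          using c by (simp add: disjoint_ranges_comp_inj[OF h])
        ultimately show ?thesis
          unfolding disjoint_copies_card_iff[OF R x D] by (intro exI[of _ "\<lambda>i. h \<circ> c i"] conjI)
      qed
      then have "\<exists>F. disjoint_copies R D F \<and> infinite F"
        using ubi D unfolding ubiquitous_def by blast
      then obtain c :: "nat \<Rightarrow> nat \<Rightarrow> 'v" where c: "\<And>i. pattern_copy ?\<sigma> (map_prod h h ` E) (c i)"
        and disj: "disjoint_ranges UNIV c"
        unfolding disjoint_copies_infinite_iff[OF R x D] by (auto simp: D_def)
      have "\<forall>i. \<exists>d. c i = h \<circ> d \<and> pattern_copy ?\<sigma> E d"
        using c unfolding pattern_copy_image[OF h] by blast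
      then obtain d where d: "\<And>i. c i = h \<circ> d i" "\<And>i. pattern_copy ?\<sigma> E (d i)" by metis
      then have "c = (\<lambda>i. h \<circ> d i)" by blast
      with disj have ddisj: "disjoint_ranges UNIV d" by (simp add: disjoint_ranges_comp_inj[OF h])
      from few show False by (rule notE) (intro exI[of _ d] conjI allI d(2) ddisj)
    qed
  next
    assume fin: "finite {n. ?\<sigma> n} \<or> finite {n. \<not> ?\<sigma> n}"
    show "ubiquitous TYPE('v) R"
      unfolding ubiquitous_def
    proof (intro allI impI)
      fix D :: "'v pair_pre_digraph"
      assume D: "pair_loopfree_digraph D"
        and "\<forall>k::nat. \<exists>F. disjoint_copies R D F \<and> finite F \<and> card F = k"
      then have many: "\<exists>c :: nat \<Rightarrow> nat \<Rightarrow> 'v. (\<forall>i<k. pattern_copy ?\<sigma> (parcs D) (c i)) \<and>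
          disjoint_ranges {..<k} c" for k
        unfolding disjoint_copies_card_iff[OF R x D] by blast
      from fin have "\<exists>c :: nat \<Rightarrow> nat \<Rightarrow> 'v. (\<forall>i. pattern_copy ?\<sigma> (parcs D) (c i)) \<and> disjoint_ranges UNIV c"
      proof
        assume "finite {n. \<not> ?\<sigma> n}"
        then obtain l where "\<And>n. l \<le> n \<Longrightarrow> ?\<sigma> n"
          unfolding finite_nat_set_iff_bounded by (metis mem_Collect_eq not_le)
        then show ?thesis using many by (rule out_tail_infinitely_many)
      next
        assume "finite {n. ?\<sigma> n}"
        then obtain l where l: "\<And>n. l \<le> n \<Longrightarrow> \<not> ?\<sigma> n"
          unfolding finite_nat_set_iff_bounded by (metis mem_Collect_eq not_le)
        \<comment> \<open>Reversing all arcs of \<open>D\<close> turns the in-oriented tail into an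
          out-oriented one.\<close>
        have "\<exists>c :: nat \<Rightarrow> nat \<Rightarrow> 'v. (\<forall>i. pattern_copy (\<lambda>n. \<not> ?\<sigma> n) ((parcs D)\<inverse>) (c i)) \<and> disjoint_ranges UNIV c"
          by (rule out_tail_infinitely_many[of l], rule l) (simp_all add: pattern_copy_converse many)
        then show ?thesis by (simp add: pattern_copy_converse)
      qed
      then show "\<exists>F. disjoint_copies R D F \<and> infinite F"
        unfolding disjoint_copies_infinite_iff[OF R x D] .
    qed
  qed
qed

end
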